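(* Let $w\ge 1$, $m\ge 1$ and $n\ge 3$ be natural numbers with $w\ne 1$, $m\neq 1$ and $n\neq 6$. Then $K_w\bigtriangledown mC_n$ is determined by its Laplacian spectrum: if $G$ is a connected graph with $\operatorname{Spec}_L(G)=\operatorname{Spec}_L(K_w\bigtriangledown mC_n)$, then $G\cong K_w\bigtriangledown mC_n$.
   Context: All graphs are finite, simple and undirected. $K_w$ is the complete graph on $w$ vertices, $C_n$ is the cycle on $n$ vertices, $mC_n$ is the disjoint union of $m$ copies of $C_n$, and the join $G\bigtriangledown H$ is obtained from the disjoint union of $G$ and $H$ by joining every vertex of $G$ to every vertex of $H$. $\operatorname{Spec}_L(G)$ denotes the multiset of eigenvalues (with multiplicities) of the Laplacian matrix $L(G)=D(G)-A(G)$, where $A(G)$ is the adjacency matrix and $D(G)$ the diagonal matrix of vertex degrees. *)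

theory Defs
  imports
    Complex_Main
    "Graph_Theory.Graph_Theory"
    "Jordan_Normal_Form.Char_Poly"
begin

text \<open>
  A finite simple undirected graph is a \<^locale>\<open>pair_graph\<close>: every edge is
  represented by both of its orientations, and there are no loops.
\<close>

definition complete_graph :: "nat \<Rightarrow> nat pair_pre_digraph" where
  "complete_graph w =
    \<lparr> pverts = {..<w}, parcs = {(u, v). u < w \<and> v < w \<and> u \<noteq> v} \<rparr>"

definition cycle_graph :: "nat \<Rightarrow> nat pair_pre_digraph" where
  "cycle_graph n =
    \<lparr> pverts = {..<n},
      parcs = {(u, v). u < n \<and> v < n \<and> (v = Suc u mod n \<or> u = Suc v mod n)} \<rparr>"

definition copies :: "nat \<Rightarrow> 'a pair_pre_digraph \<Rightarrow> (nat \<times> 'a) pair_pre_digraph" where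
  "copies m G =
    \<lparr> pverts = {..<m} \<times> pverts G,
      parcs = {((i, u), (j, v)). i < m \<and> j = i \<and> (u, v) \<in> parcs G} \<rparr>"

definition graph_join ::
  "'a pair_pre_digraph \<Rightarrow> 'b pair_pre_digraph \<Rightarrow> ('a + 'b) pair_pre_digraph"
  (infixr \<open>\<bigtriangledown>\<close> 65) where
  "G \<bigtriangledown> H =
    \<lparr> pverts = pverts G <+> pverts H,
      parcs = {(Inl u, Inl v) | u v. (u, v) \<in> parcs G}
            \<union> {(Inr u, Inr v) | u v. (u, v) \<in> parcs H}
            \<union> {(Inl u, Inr v) | u v. u \<in> pverts G \<and> v \<in> pverts H}
            \<union> {(Inr v, Inl u) | u v. u \<in> pverts G \<and> v \<in> pverts H} \<rparr>"

lemma complete_graph_is_complete: "complete_digraph w (with_proj (complete_graph w))"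
  unfolding complete_digraph_pair_def by (auto simp: complete_graph_def)

lemma pair_graph_complete_graph: "pair_graph (complete_graph w)"
  using complete_graph_is_complete by (rule pair_graphI_complete)

lemma pair_graph_cycle_graph:
  assumes "n \<ge> 2"
  shows "pair_graph (cycle_graph n)"
proof -
  have "finite (parcs (cycle_graph n))"
    by (rule finite_subset[of _ "{..<n} \<times> {..<n}"]) (auto simp: cycle_graph_def)
  moreover have "Suc u mod n \<noteq> u" if "u < n" for u
    using assms that by (cases "Suc u = n") auto
  ultimately show ?thesis
    by unfold_locales (auto simp: cycle_graph_def symmetric_def sym_def, metis)
qed

lemma pair_graph_copies:
  assumes "pair_graph G"
  shows "pair_graph (copies m G)"
proof -
  interpret pair_graph G by fact
  have "finite (parcs (copies m G))"
    by (rule finite_subset[of _ "({..<m} \<times> pverts G) \<times> ({..<m} \<times> pverts G)"])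
      (auto simp: copies_def dest: in_arcsD1 in_arcsD2)
  then show ?thesis
    using pair_sym_arcs
    by unfold_locales
      (auto simp: copies_def symmetric_def sym_def pair_finite_verts
        dest: in_arcsD1 in_arcsD2 pair_no_loops)
qed

lemma pair_graph_join:
  assumes "pair_graph G" "pair_graph H"
  shows "pair_graph (G \<bigtriangledown> H)"
proof -
  interpret G: pair_graph G by fact
  interpret H: pair_graph H by fact
  let ?V = "pverts G <+> pverts H"
  have fin: "finite ?V"
    by (simp add: G.pair_finite_verts H.pair_finite_verts)
  have "finite (parcs (G \<bigtriangledown> H))"
    by (rule finite_subset[of _ "?V \<times> ?V"])
      (auto simp: fin graph_join_def simp del: finite_Plus_iff
        dest: G.in_arcsD1 G.in_arcsD2 H.in_arcsD1 H.in_arcsD2)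
  then show ?thesis
    using fin G.pair_sym_arcs H.pair_sym_arcs
    by unfold_locales
      (auto simp: graph_join_def symmetric_def sym_def
        dest: G.in_arcsD1 G.in_arcsD2 H.in_arcsD1 H.in_arcsD2 G.pair_no_loops H.pair_no_loops)
qed

text \<open>
  Matrices are indexed by natural numbers, so the vertices are listed as
  \<open>vs\<close>: row and column \<open>i\<close> belong to the vertex \<open>vs ! i\<close>. In a symmetric
  graph the out-degree is the degree.
\<close>

definition adjacency_matrix :: "'a pair_pre_digraph \<Rightarrow> 'a list \<Rightarrow> complex mat" where
  "adjacency_matrix G vs =
    mat (length vs) (length vs) (\<lambda>(i, j). if (vs ! i, vs ! j) \<in> parcs G then 1 else 0)"

definition degree_matrix :: "'a pair_pre_digraph \<Rightarrow> 'a list \<Rightarrow> complex mat" where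
  "degree_matrix G vs =
    mat (length vs) (length vs)
      (\<lambda>(i, j). if i = j then of_nat (out_degree (with_proj G) (vs ! i)) else 0)"

definition laplacian_matrix :: "'a pair_pre_digraph \<Rightarrow> 'a list \<Rightarrow> complex mat" where
  "laplacian_matrix G vs = degree_matrix G vs - adjacency_matrix G vs"

definition laplacian_spectrum :: "'a pair_pre_digraph \<Rightarrow> complex multiset" where
  "laplacian_spectrum G =
    proots (char_poly (laplacian_matrix G (SOME vs. distinct vs \<and> set vs = pverts G)))"

lemma char_poly_laplacian_matrix_cong:
  assumes "distinct vs" "distinct ws" "set vs = set ws"
  shows "char_poly (laplacian_matrix G vs) = char_poly (laplacian_matrix G ws)"
proof -
  let ?n = "length ws"
  have "mset vs = mset ws"
    using assms by (simp add: set_eq_iff_mset_eq_distinct)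
  then obtain p where p: "p permutes {..<?n}" and vs: "permute_list p ws = vs"
    by (rule mset_eq_permutation)
  have len: "length vs = ?n" using vs by auto
  have p0: "p permutes {0..<?n}" using p by (simp add: atLeast0LessThan)
  have nth: "vs ! i = ws ! p i" if "i < ?n" for i
    using permute_list_nth[OF p that] vs by simp
  have pl: "p i < ?n" if "i < ?n" for i
    using permutes_in_image[OF p] that by auto
  have pe: "p i = p j \<longleftrightarrow> i = j" for i j
    using permutes_inj[OF p] by (auto dest: injD)
  let ?A = "char_poly_matrix (laplacian_matrix G ws)"
  have cA: "?A \<in> carrier_mat ?n ?n"
    by (auto simp: char_poly_matrix_def laplacian_matrix_def adjacency_matrix_def)
  let ?B = "mat ?n ?n (\<lambda>(i, j). ?A $$ (p i, j))"
  have "char_poly_matrix (laplacian_matrix G vs) = mat ?n ?n (\<lambda>(i, j). ?B $$ (i, p j))"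
    by (rule eq_matI)
      (auto simp: char_poly_matrix_def laplacian_matrix_def adjacency_matrix_def
        degree_matrix_def len nth pl pe)
  then have "char_poly (laplacian_matrix G vs) = det (mat ?n ?n (\<lambda>(i, j). ?B $$ (i, p j)))"
    by (simp add: char_poly_def)
  also have "mat ?n ?n (\<lambda>(i, j). ?B $$ (i, p j))
      = transpose_mat (mat ?n ?n (\<lambda>(i, j). transpose_mat ?B $$ (p i, j)))"
    by (rule eq_matI) (auto simp: pl)
  also have "det \<dots> = det (mat ?n ?n (\<lambda>(i, j). transpose_mat ?B $$ (p i, j)))"
    by (rule det_transpose) auto
  also have "\<dots> = of_int (sign p) * det (transpose_mat ?B)"
    by (rule det_permute_rows[OF _ p0]) auto
  also have "det (transpose_mat ?B) = det ?B"
    by (rule det_transpose) auto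
  also have "det ?B = of_int (sign p) * det ?A"
    by (rule det_permute_rows[OF cA p0])
  also have "of_int (sign p) * (of_int (sign p) * det ?A) = det ?A"
    by (cases "sign p = 1") (auto simp: sign_def)
  finally show ?thesis by (simp add: char_poly_def)
qed

text \<open>The spectrum does not depend on the enumeration of the vertices.\<close>

lemma laplacian_spectrum_eq:
  assumes "distinct vs" "set vs = pverts G"
  shows "laplacian_spectrum G = proots (char_poly (laplacian_matrix G vs))"
proof -
  let ?ws = "SOME ws. distinct ws \<and> set ws = pverts G"
  have "distinct ?ws \<and> set ?ws = pverts G"
    by (rule someI[of _ vs]) (simp add: assms)
  then show ?thesis
    unfolding laplacian_spectrum_def
    using char_poly_laplacian_matrix_cong[of ?ws vs G] assms by simp
qed

end

theory Submission
  imports Defs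
    "Jordan_Normal_Form.Jordan_Normal_Form_Existence"
    "Jordan_Normal_Form.Jordan_Normal_Form_Uniqueness"
begin

text \<open>
  Let \<open>N = w + m * n\<close> be the number of vertices. The complement of
  \<open>K\<^sub>w \<bigtriangledown> m C\<^sub>n\<close> consists of \<open>w\<close> isolated
  vertices and one component with \<open>m * n\<close> vertices, and the spectrum forces this
  shape on the complement of every cospectral graph \<open>G\<close>. On the one hand,
  eigenfunctions of \<open>G\<close> for \<open>N\<close> are harmonic on the complement, and
  \<open>N\<close> has multiplicity \<open>w\<close>, so the complement has at least
  \<open>w + 1\<close> components (\<open>complement_components_cospectral\<close>). On the other
  hand, \<open>w\<close> is an eigenvalue of \<open>G\<close> because \<open>m \<ge> 2\<close>. On
  the complement it turns into \<open>m * n\<close>, and an eigenvalue of a graph is at most the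
  size of a component that supports an eigenfunction
  (\<open>eigenvalue_le_card_component\<close>). So one component has at least
  \<open>m * n\<close> vertices, and the at least \<open>w\<close> others share at most
  \<open>w\<close> vertices. They are single vertices, so \<open>G\<close> is the join of
  \<open>w\<close> dominating vertices with a graph \<open>H\<close> on \<open>m * n\<close>
  vertices (\<open>dominating_vertices\<close>).

  The traces of \<open>L\<close> and \<open>L\<^sup>2\<close> determine the sum of the degrees and
  of their squares, which makes \<open>H\<close> two-regular
  (\<open>two_regular_cospectral\<close>), hence a disjoint union of cycles. The multiplicity of
  \<open>w\<close> shows that there are at most \<open>m\<close> cycles
  (\<open>card_components_cospectral\<close>). A cycle of length \<open>l\<close> contributes the
  eigenvalue \<open>w + 2 - z - 1 / z\<close> with a primitive \<open>l\<close>-th root of unity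
  \<open>z\<close>. In \<open>K\<^sub>w \<bigtriangledown> m C\<^sub>n\<close> this eigenvalue
  comes from an \<open>n\<close>-cycle, which is possible only if \<open>z ^ n = 1\<close>, so
  \<open>l \<le> n\<close> (\<open>cycle_length_le_cospectral\<close>). At most \<open>m\<close>
  cycles of length at most \<open>n\<close> cover \<open>m * n\<close> vertices only if there are
  \<open>m\<close> cycles of length \<open>n\<close>.

  Multiplicities enter through \<open>card_independent_eigenfunctions_le\<close> alone. The
  Laplacian is Hermitian, so the spectrum fixes the dimension of each eigenspace. Consequently a
  family of independent eigenfunctions of one graph is no larger than a set of vertices on which
  the eigenfunctions of the other graph are determined.
\<close>

section \<open>Kernel dimensions and Hermitian matrices\<close>

text \<open>
  Gaussian elimination: an equation with a nonzero coefficient is used to remove one equation and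
  one unknown.
\<close>

lemma homogeneous_system_nontrivial_solution:
  fixes M :: "'j \<Rightarrow> 'i \<Rightarrow> 'a::field"
  assumes "finite J" "finite I" "card J < card I"
  shows "\<exists>c. (\<exists>i\<in>I. c i \<noteq> 0) \<and> (\<forall>j\<in>J. (\<Sum>i\<in>I. M j i * c i) = 0)"
  using assms
proof (induction J arbitrary: I M rule: finite_induct)
  case empty
  then have "I \<noteq> {}" by auto
  then show ?case by (intro exI[of _ "\<lambda>_. 1"]) auto
next
  case (insert j J)
  show ?case
  proof (cases "\<forall>i\<in>I. M j i = 0")
    case True
    have "card J < card I" using insert by simp
    then obtain c where "\<exists>i\<in>I. c i \<noteq> 0" "\<forall>k\<in>J. (\<Sum>i\<in>I. M k i * c i) = 0"
      using insert.IH[OF insert.prems(1)] by blast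
    then show ?thesis using True by (intro exI[of _ c]) auto
  next
    case False
    then obtain p where p: "p \<in> I" "M j p \<noteq> 0" by blast
    \<comment> \<open>The coefficients after elimination of the unknown \<open>p\<close> with the equation \<open>j\<close>.\<close>
    define N where "N k i = M k i - M k p * M j i / M j p" for k i
    have "card J < card (I - {p})" using insert p by simp
    then obtain c where c: "\<exists>i\<in>I - {p}. c i \<noteq> 0" "\<forall>k\<in>J. (\<Sum>i\<in>I - {p}. N k i * c i) = 0"
      using insert.IH[of "I - {p}" N] insert.prems(1) by blast
    define s where "s = (\<Sum>i\<in>I - {p}. M j i * c i)"
    define d where "d = c(p := - s / M j p)"
    have split: "(\<Sum>i\<in>I. M k i * d i) = M k p * d p + (\<Sum>i\<in>I - {p}. M k i * c i)" for k
      using insert.prems(1) p by (subst sum.remove[of I p]) (auto simp: d_def intro!: sum.cong)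
    have "(\<Sum>i\<in>I. M j i * d i) = 0"
      using p by (simp add: split) (simp add: d_def s_def)
    moreover have "(\<Sum>i\<in>I. M k i * d i) = 0" if "k \<in> J" for k
    proof -
      have "0 = (\<Sum>i\<in>I - {p}. N k i * c i)" using c that by simp
      also have "\<dots> = (\<Sum>i\<in>I - {p}. M k i * c i) - M k p / M j p * s"
        by (simp add: N_def s_def algebra_simps sum_subtractf sum_distrib_left)
      finally show ?thesis using p by (simp add: split) (simp add: d_def)
    qed
    moreover have "\<exists>i\<in>I. d i \<noteq> 0" using c(1) by (auto simp: d_def)
    ultimately show ?thesis by (intro exI[of _ d]) auto
  qed
qed

text \<open>
  Together with the next lemma, this gives bounds for a kernel dimension by finite families, so
  that later arguments never have to choose a basis.
\<close>

lemma card_independent_le_kernel_dim: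
  fixes A :: "'a::field mat"
  assumes A: "A \<in> carrier_mat nr n" and I: "finite I"
    and f: "\<And>i. i \<in> I \<Longrightarrow> f i \<in> mat_kernel A"
    and indep: "\<And>c. (\<And>r. r < n \<Longrightarrow> (\<Sum>i\<in>I. c i * f i $ r) = 0) \<Longrightarrow> \<forall>i\<in>I. c i = 0"
  shows "card I \<le> kernel_dim A"
proof (rule ccontr)
  interpret kernel nr n A by unfold_locales fact
  assume less: "\<not> card I \<le> kernel_dim A"
  obtain B where fin: "finite B" and B: "basis B" using kernel_basis_exists[OF A] by auto
  have Bk: "B \<subseteq> mat_kernel A" and gen: "span B = mat_kernel A"
    using B by (auto simp: Ker.basis_def)
  have "card B = kernel_dim A" using Ker.dim_basis[OF fin B] by simp
  have "\<exists>a. f i = lincomb a B" if "i \<in> I" for i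
    using f[OF that] Ker.finite_span[OF fin] Bk gen by auto
  then obtain a where a: "\<And>i. i \<in> I \<Longrightarrow> f i = lincomb (a i) B" by metis
  obtain c where c: "\<exists>i\<in>I. c i \<noteq> 0" "\<forall>b\<in>B. (\<Sum>i\<in>I. a i b * c i) = 0"
    using homogeneous_system_nontrivial_solution[OF fin I, of "\<lambda>b i. a i b"] less
      \<open>card B = kernel_dim A\<close> by auto
  have "(\<Sum>i\<in>I. c i * f i $ r) = 0" if r: "r < n" for r
  proof -
    have "(\<Sum>i\<in>I. c i * f i $ r) = (\<Sum>i\<in>I. \<Sum>b\<in>B. c i * (a i b * b $ r))"
      using a by (intro sum.cong refl) (simp add: lincomb_index[OF r Bk] sum_distrib_left)
    also have "\<dots> = (\<Sum>b\<in>B. b $ r * (\<Sum>i\<in>I. a i b * c i))"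
      by (subst sum.swap) (simp add: sum_distrib_left mult_ac)
    finally show ?thesis using c by simp
  qed
  then show False using indep c(1) by blast
qed

text \<open>
  Evaluation at the coordinates in \<open>J\<close> is an injective linear map on the kernel.
\<close>

lemma kernel_dim_le_card_determining:
  fixes A :: "'a::field mat"
  assumes A: "A \<in> carrier_mat nr n" and J: "finite J"
    and det: "\<And>v. v \<in> mat_kernel A \<Longrightarrow> (\<And>j. j \<in> J \<Longrightarrow> v $ j = 0) \<Longrightarrow> v = 0\<^sub>v n"
    and Jn: "J \<subseteq> {..<n}"
  shows "kernel_dim A \<le> card J"
proof (rule ccontr)
  interpret kernel nr n A by unfold_locales fact
  assume less: "\<not> kernel_dim A \<le> card J"
  obtain B where fin: "finite B" and B: "basis B" using kernel_basis_exists[OF A] by auto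
  have Bk: "B \<subseteq> mat_kernel A" and indep: "lin_indpt B"
    using B by (auto simp: Ker.basis_def)
  have "card B = kernel_dim A" using Ker.dim_basis[OF fin B] by simp
  then obtain c where c: "\<exists>b\<in>B. c b \<noteq> 0" "\<forall>j\<in>J. (\<Sum>b\<in>B. b $ j * c b) = 0"
    using homogeneous_system_nontrivial_solution[OF J fin, of "\<lambda>j b. b $ j"] less by auto
  have "lincomb c B = 0\<^sub>v n"
  proof (rule det)
    show "lincomb c B \<in> mat_kernel A" using Ker.lincomb_closed[OF Bk] by auto
    show "lincomb c B $ j = 0" if "j \<in> J" for j
      using that Jn c(2) by (subst lincomb_index[OF _ Bk]) (auto simp: mult.commute)
  qed
  then show False using indep fin c(1) by (auto simp: Ker.lin_dep_def)
qed

text \<open>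
  If \<open>A A x = 0\<close>, then
  \<open>\<parallel>A x\<parallel>\<^sup>2 = \<langle>x, A A x\<rangle> = 0\<close>.
\<close>

lemma kernel_square_hermitian:
  fixes A :: "complex mat"
  assumes A: "A \<in> carrier_mat n n"
    and herm: "\<And>i j. i < n \<Longrightarrow> j < n \<Longrightarrow> A $$ (i, j) = cnj (A $$ (j, i))"
  shows "mat_kernel (A * A) = mat_kernel A"
proof
  show "mat_kernel A \<subseteq> mat_kernel (A * A)"
    using A mat_kernel_mult_subset by blast
  show "mat_kernel (A * A) \<subseteq> mat_kernel A"
  proof
    fix x assume "x \<in> mat_kernel (A * A)"
    then have x: "x \<in> carrier_vec n" and AA: "A *\<^sub>v (A *\<^sub>v x) = 0\<^sub>v n"
      using A mat_kernelD[of "A * A" n n x] by auto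
    define y where "y = A *\<^sub>v x"
    have y: "y \<in> carrier_vec n" using A x by (auto simp: y_def)
    have Ay: "(\<Sum>j<n. A $$ (i, j) * y $ j) = 0" if "i < n" for i
    proof -
      have "(A *\<^sub>v y) $ i = 0" using AA that by (simp add: y_def)
      then show ?thesis using A y that by (auto simp: scalar_prod_def atLeast0LessThan)
    qed
    have yi: "y $ i = (\<Sum>j<n. A $$ (i, j) * x $ j)" if "i < n" for i
      using A x that by (auto simp: scalar_prod_def atLeast0LessThan y_def)
    have "(\<Sum>i<n. y $ i * cnj (y $ i)) = (\<Sum>i<n. \<Sum>j<n. y $ i * cnj (A $$ (i, j) * x $ j))"
      using yi by (simp add: sum_distrib_left)
    also have "\<dots> = (\<Sum>j<n. cnj (x $ j) * (\<Sum>i<n. A $$ (j, i) * y $ i))"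
      by (subst sum.swap) (auto simp: sum_distrib_left mult_ac herm[symmetric] intro!: sum.cong)
    also have "\<dots> = 0" using Ay by simp
    finally have "complex_of_real (\<Sum>i<n. (cmod (y $ i))\<^sup>2) = 0"
      by (simp add: complex_norm_square[symmetric])
    then have "(\<Sum>i<n. (cmod (y $ i))\<^sup>2) = 0" by (simp only: of_real_eq_0_iff)
    then have "\<forall>i<n. y $ i = 0" by (subst (asm) sum_nonneg_eq_0_iff) auto
    then have "y = 0\<^sub>v n" using y by auto
    then show "x \<in> mat_kernel A" using A x by (auto simp: y_def intro: mat_kernelI)
  qed
qed

text \<open>
  Geometric and algebraic multiplicity agree: squaring \<open>A - e\<close> does not enlarge the
  kernel, so no Jordan block for \<open>e\<close> has size two or more.
\<close>

lemma kernel_dim_hermitian: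
  fixes A :: "complex mat"
  assumes A: "A \<in> carrier_mat n n"
    and herm: "\<And>i j. i < n \<Longrightarrow> j < n \<Longrightarrow> A $$ (i, j) = cnj (A $$ (j, i))"
    and e: "cnj e = e"
  shows "kernel_dim (char_matrix A e) = Polynomial.order e (char_poly A)"
proof -
  let ?M = "char_matrix A e"
  have M: "?M \<in> carrier_mat n n" using A by auto
  obtain as where "char_poly A = (\<Prod>a\<leftarrow>as. [:- a, 1:])" using char_poly_factorized[OF A] by blast
  then obtain nas where nas: "jordan_nf A nas" using jordan_nf_exists[OF A] by blast
  define bs where "bs = map fst (filter (\<lambda>(n, a). a = e) nas)"
  have "?M $$ (i, j) = cnj (?M $$ (j, i))" if "i < n" "j < n" for i j
  proof -
    have "?M $$ (i, j) = A $$ (i, j) + (if i = j then - e else 0)" if "i < n" "j < n" for i j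
      using A that by (simp add: char_matrix_def)
    then show ?thesis using that e by (simp add: herm[OF that])
  qed
  then have "mat_kernel (?M * ?M) = mat_kernel ?M"
    by (rule kernel_square_hermitian[OF M])
  then have "kernel_dim (?M * ?M) = kernel_dim ?M"
    using M by (simp add: kernel_dim_def)
  moreover have "?M ^\<^sub>m 2 = ?M * ?M" "?M ^\<^sub>m 1 = ?M"
    using M by (auto simp: numeral_2_eq_2)
  ultimately have "dim_gen_eigenspace A e 2 = dim_gen_eigenspace A e 1"
    by (simp add: dim_gen_eigenspace_def)
  \<comment> \<open>\<open>bs\<close> holds the sizes of the Jordan blocks for \<open>e\<close>, and a block of size \<open>n\<close> adds
    \<open>min k n\<close> to the dimension of the kernel of the \<open>k\<close>-th power.\<close>
  then have eq: "(\<Sum>n\<leftarrow>bs. min 2 n) = (\<Sum>n\<leftarrow>bs. min 1 n)"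
    by (simp add: dim_gen_eigenspace[OF nas] bs_def)
  have le: "(\<Sum>n\<leftarrow>xs. min 1 n) \<le> (\<Sum>n\<leftarrow>xs. min 2 n)" for xs :: "nat list"
    by (intro sum_list_mono) auto
  have "(\<Sum>n\<leftarrow>xs. min 2 n) = (\<Sum>n\<leftarrow>xs. min 1 n) \<Longrightarrow> (\<Sum>n\<leftarrow>xs. min 1 n) = sum_list xs"
    for xs :: "nat list"
  proof (induction xs)
    case (Cons a xs)
    then show ?case using le[of xs] by (cases "a \<le> 1") (auto simp: min_def)
  qed simp
  from this[OF eq] have "dim_gen_eigenspace A e 1 = sum_list bs"
    by (simp add: dim_gen_eigenspace[OF nas] bs_def)
  moreover have "sum_list bs = Polynomial.order e (char_poly A)"
    by (simp add: jordan_nf_order[OF nas] bs_def case_prod_unfold)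
  ultimately show ?thesis using \<open>?M ^\<^sub>m 1 = ?M\<close> by (simp add: dim_gen_eigenspace_def)
qed

section \<open>Traces and characteristic roots\<close>

lemma proots_linear_factors:
  "proots (\<Prod>a\<leftarrow>as. [:- a, 1:]) = mset as" for as :: "complex list"
proof (induction as)
  case (Cons a as)
  have "(\<Prod>a\<leftarrow>as. [:- a, 1:]) \<noteq> 0" by (auto simp: prod_list_zero_iff)
  then have "proots ([:- a, 1:] * (\<Prod>a\<leftarrow>as. [:- a, 1:]))
      = proots [:- a, 1:] + proots (\<Prod>a\<leftarrow>as. [:- a, 1:])"
    by (intro proots_mult) auto
  then show ?case by (simp add: Cons)
qed simp

lemma trace_mult_commute:
  fixes A B :: "complex mat"
  assumes "A \<in> carrier_mat n n" "B \<in> carrier_mat n n"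
  shows "(\<Sum>i<n. (A * B) $$ (i, i)) = (\<Sum>i<n. (B * A) $$ (i, i))"
proof -
  have "(X * Y) $$ (i, i) = (\<Sum>k<n. X $$ (i, k) * Y $$ (k, i))"
    if "X \<in> carrier_mat n n" "Y \<in> carrier_mat n n" "i < n" for X Y :: "complex mat" and i
    using that by (auto simp: scalar_prod_def atLeast0LessThan)
  then show ?thesis using assms
    by simp (subst sum.swap, simp add: mult.commute)
qed

lemma size_proots_char_poly:
  fixes A :: "complex mat"
  assumes A: "A \<in> carrier_mat n n"
  shows "size (proots (char_poly A)) = n"
  using char_poly_factorized[OF A] proots_linear_factors by auto

text \<open>
  A Schur decomposition is a similarity to an upper triangular matrix whose diagonal lists the
  roots, and the square of that matrix has their squares on its diagonal.
\<close>

lemma trace_eq_sum_proots: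
  fixes A :: "complex mat"
  assumes A: "A \<in> carrier_mat n n"
  shows "(\<Sum>i<n. A $$ (i, i)) = (\<Sum>e\<in>#proots (char_poly A). e)"
    and "(\<Sum>i<n. (A * A) $$ (i, i)) = (\<Sum>e\<in>#proots (char_poly A). e\<^sup>2)"
proof -
  obtain es where es: "char_poly A = (\<Prod>a\<leftarrow>es. [:- a, 1:])"
    using char_poly_factorized[OF A] by blast
  obtain B P Q where BPQ: "schur_decomposition A es = (B, P, Q)"
    by (cases "schur_decomposition A es") auto
  have wit: "similar_mat_wit A B P Q" and ut: "upper_triangular B" and diag: "diag_mat B = es"
    using schur_decomposition[OF A es BPQ] by auto
  have B: "B \<in> carrier_mat n n"
    using similar_mat_witD2[OF A wit] by auto
  have tr: "(\<Sum>i<n. X $$ (i, i)) = (\<Sum>i<n. Y $$ (i, i))"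
    if wit: "similar_mat_wit X Y R S" and X: "X \<in> carrier_mat n n" for X Y R S :: "complex mat"
  proof -
    note w = similar_mat_witD2[OF X wit]
    have "(\<Sum>i<n. X $$ (i, i)) = (\<Sum>i<n. (R * Y * S) $$ (i, i))" using w by simp
    also have "\<dots> = (\<Sum>i<n. (S * (R * Y)) $$ (i, i))"
      by (rule trace_mult_commute) (use w in auto)
    also have "S * (R * Y) = S * R * Y"
      using w by (intro assoc_mult_mat[symmetric]) auto
    also have "\<dots> = Y" using w by auto
    finally show ?thesis .
  qed
  have len: "length es = n" using B diag by (auto simp: diag_mat_def)
  have Bii: "B $$ (i, i) = es ! i" if "i < n" for i
    using that B unfolding diag[symmetric] by (simp add: diag_mat_def)
  have sl: "(\<Sum>i<n. h (es ! i)) = (\<Sum>e\<in>#proots (char_poly A). h e)" for h :: "complex \<Rightarrow> complex"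
    unfolding es proots_linear_factors
    by (simp add: sum_mset_sum_list sum_list_sum_nth len atLeast0LessThan flip: mset_map)
  show "(\<Sum>i<n. A $$ (i, i)) = (\<Sum>e\<in>#proots (char_poly A). e)"
    using tr[OF wit A] sl[of "\<lambda>e. e"] Bii by simp
  have AA: "A * A \<in> carrier_mat n n" using A by auto
  have "similar_mat_wit (A ^\<^sub>m 2) (B ^\<^sub>m 2) P Q" by (rule similar_mat_wit_pow[OF wit])
  moreover have "A ^\<^sub>m 2 = A * A" "B ^\<^sub>m 2 = B * B"
    using A B by (auto simp: numeral_2_eq_2)
  ultimately have wit2: "similar_mat_wit (A * A) (B * B) P Q" by simp
  have "(B * B) $$ (i, i) = (es ! i)\<^sup>2" if i: "i < n" for i
  proof -
    have "(B * B) $$ (i, i) = (\<Sum>k<n. B $$ (i, k) * B $$ (k, i))"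
      using B i by (auto simp: scalar_prod_def atLeast0LessThan)
    also have "\<dots> = (\<Sum>k<n. if k = i then (B $$ (i, i))\<^sup>2 else 0)"
    proof (intro sum.cong refl)
      fix k assume "k \<in> {..<n}"
      then show "B $$ (i, k) * B $$ (k, i) = (if k = i then (B $$ (i, i))\<^sup>2 else 0)"
        using ut B i by (cases k i rule: linorder_cases) (auto simp: upper_triangular_def power2_eq_square)
    qed
    finally show ?thesis using i Bii by simp
  qed
  then show "(\<Sum>i<n. (A * A) $$ (i, i)) = (\<Sum>e\<in>#proots (char_poly A). e\<^sup>2)"
    using tr[OF wit2 AA] sl[of "\<lambda>e. e\<^sup>2"] by simp
qed

section \<open>Laplacian eigenfunctions of cospectral graphs\<close>

text \<open>
  The Laplacian as an operator on functions on the vertices. From here on a graph is a pair of a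
  vertex set and an edge relation, which makes induced subgraphs and complements graphs on the
  same vertex type.
\<close>

definition lap :: "('a \<times> 'a) set \<Rightarrow> ('a \<Rightarrow> complex) \<Rightarrow> 'a \<Rightarrow> complex" where
  "lap E x v = (\<Sum>u\<in>E `` {v}. x v - x u)"

definition eigenfunction :: "'a set \<Rightarrow> ('a \<times> 'a) set \<Rightarrow> complex \<Rightarrow> ('a \<Rightarrow> complex) \<Rightarrow> bool" where
  "eigenfunction V E \<mu> x \<longleftrightarrow> (\<forall>v\<in>V. lap E x v = \<mu> * x v)"

definition simple_graph :: "'a set \<Rightarrow> ('a \<times> 'a) set \<Rightarrow> bool" where
  "simple_graph V E \<longleftrightarrow> finite V \<and> E \<subseteq> V \<times> V \<and> sym E \<and> irrefl E"

lemma simple_graph_pair_graph: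
  assumes "pair_graph G"
  shows "simple_graph (pverts G) (parcs G)"
proof -
  interpret pair_graph G by fact
  have "(v, v) \<notin> parcs G" for v using pair_no_loops[of "(v, v)"] by auto
  then show ?thesis using pair_finite_verts in_arcsD1 in_arcsD2 pair_sym_arcs
    by (auto simp: simple_graph_def irrefl_def symmetric_def)
qed

lemma simple_graphD:
  assumes "simple_graph V E"
  shows "finite V" "finite (E `` X)" "E `` X \<subseteq> V" "(u, v) \<in> E \<longleftrightarrow> (v, u) \<in> E" "(v, v) \<notin> E"
    "(u, v) \<in> E \<Longrightarrow> u \<in> V" "(u, v) \<in> E \<Longrightarrow> v \<in> V" "finite E"
proof -
  show "E `` X \<subseteq> V" using assms by (auto simp: simple_graph_def)
  then show "finite (E `` X)" using assms finite_subset by (auto simp: simple_graph_def)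
  show "finite E" using assms finite_subset[of E "V \<times> V"] by (auto simp: simple_graph_def)
qed (use assms in \<open>auto simp: simple_graph_def sym_def irrefl_def\<close>)

lemma out_degree_with_proj: "out_degree (with_proj G) v = card (parcs G `` {v})"
proof -
  have "{e \<in> parcs G. fst e = v} = Pair v ` (parcs G `` {v})" by force
  then show ?thesis by (simp add: out_degree_def out_arcs_def card_image inj_on_def)
qed

lemma laplacian_matrix_carrier: "laplacian_matrix G vs \<in> carrier_mat (length vs) (length vs)"
  by (rule carrier_matI) (simp_all add: laplacian_matrix_def degree_matrix_def adjacency_matrix_def)

lemma laplacian_matrix_index:
  assumes "i < length vs" "j < length vs"
  shows "laplacian_matrix G vs $$ (i, j)
    = (if i = j then of_nat (card (parcs G `` {vs ! i})) else 0)
      - (if (vs ! i, vs ! j) \<in> parcs G then 1 else 0)"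
  using assms by (simp add: laplacian_matrix_def degree_matrix_def adjacency_matrix_def
      out_degree_with_proj)

lemma sum_nth_eq_sum_set:
  assumes "distinct vs"
  shows "(\<Sum>i<length vs. h (vs ! i)) = sum h (set vs)"
  using assms by (metis bij_betw_nth lessThan_atLeast0 sum.reindex_bij_betw)

lemma laplacian_matrix_mult_vec:
  assumes G: "simple_graph (pverts G) (parcs G)" and vs: "distinct vs" "set vs = pverts G"
    and i: "i < length vs"
  shows "(laplacian_matrix G vs *\<^sub>v vec (length vs) (\<lambda>i. x (vs ! i))) $ i = lap (parcs G) x (vs ! i)"
proof -
  let ?n = "length vs" and ?E = "parcs G" and ?v = "vs ! i"
  have "(laplacian_matrix G vs *\<^sub>v vec ?n (\<lambda>i. x (vs ! i))) $ i
      = (\<Sum>j<?n. laplacian_matrix G vs $$ (i, j) * x (vs ! j))"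
    using laplacian_matrix_carrier[of G vs] i
    by (auto simp: scalar_prod_def atLeast0LessThan)
  also have "\<dots> = (\<Sum>j<?n. (if i = j then of_nat (card (?E `` {?v})) * x ?v else 0))
      - (\<Sum>j<?n. if (?v, vs ! j) \<in> ?E then x (vs ! j) else 0)"
    unfolding sum_subtractf[symmetric]
    by (intro sum.cong refl) (auto simp: laplacian_matrix_index i algebra_simps)
  also have "(\<Sum>j<?n. (if i = j then of_nat (card (?E `` {?v})) * x ?v else 0))
      = (\<Sum>u\<in>?E `` {?v}. x ?v)" using i by simp
  also have "(\<Sum>j<?n. if (?v, vs ! j) \<in> ?E then x (vs ! j) else 0)
      = (\<Sum>u\<in>set vs. if (?v, u) \<in> ?E then x u else 0)"
    by (rule sum_nth_eq_sum_set[OF vs(1), of "\<lambda>u. if (?v, u) \<in> ?E then x u else 0"])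
  also have "\<dots> = (\<Sum>u\<in>?E `` {?v}. x u)"
    using simple_graphD(1,3)[OF G] by (intro sum.mono_neutral_cong_right) (auto simp: vs)
  finally show ?thesis by (simp add: lap_def sum_subtractf)
qed

text \<open>
  The dictionary between vectors, indexed by a list of the vertices, and functions on the
  vertices.
\<close>

lemma vec_in_kernel_iff_eigenfunction:
  assumes G: "simple_graph (pverts G) (parcs G)" and vs: "distinct vs" "set vs = pverts G"
  shows "vec (length vs) (\<lambda>i. x (vs ! i)) \<in> mat_kernel (char_matrix (laplacian_matrix G vs) \<mu>)
    \<longleftrightarrow> eigenfunction (pverts G) (parcs G) \<mu> x"
proof -
  let ?n = "length vs" and ?L = "laplacian_matrix G vs"
  let ?v = "vec ?n (\<lambda>i. x (vs ! i))"
  have L: "?L \<in> carrier_mat ?n ?n" by (rule laplacian_matrix_carrier)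
  have "char_matrix ?L \<mu> *\<^sub>v ?v = ?L *\<^sub>v ?v - \<mu> \<cdot>\<^sub>v ?v"
    using L by (auto simp: char_matrix_def add_mult_distrib_mat_vec[of _ ?n ?n] intro!: eq_vecI)
  then have "(char_matrix ?L \<mu> *\<^sub>v ?v) $ i = lap (parcs G) x (vs ! i) - \<mu> * x (vs ! i)" if "i < ?n" for i
    using that laplacian_matrix_mult_vec[OF G vs that, of x] L by simp
  moreover have "char_matrix ?L \<mu> \<in> carrier_mat ?n ?n" using L by simp
  ultimately have "?v \<in> mat_kernel (char_matrix ?L \<mu>)
      \<longleftrightarrow> (\<forall>i<?n. lap (parcs G) x (vs ! i) - \<mu> * x (vs ! i) = 0)"
    by (auto simp: mat_kernel vec_eq_iff)
  then show ?thesis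
    by (simp add: eigenfunction_def vs(2)[symmetric] all_set_conv_all_nth)
qed

lemma order_char_poly_laplacian:
  assumes vs: "distinct vs" "set vs = pverts G"
  shows "Polynomial.order \<mu> (char_poly (laplacian_matrix G vs)) = count (laplacian_spectrum G) \<mu>"
proof -
  have "char_poly (laplacian_matrix G vs) \<noteq> 0"
    using degree_monic_char_poly[OF laplacian_matrix_carrier[of G vs]] by auto
  then show ?thesis by (simp add: laplacian_spectrum_eq[OF vs])
qed

lemma kernel_dim_laplacian:
  assumes G: "simple_graph (pverts G) (parcs G)" and vs: "distinct vs" "set vs = pverts G"
    and \<mu>: "cnj \<mu> = \<mu>"
  shows "kernel_dim (char_matrix (laplacian_matrix G vs) \<mu>) = count (laplacian_spectrum G) \<mu>"
proof -
  have "laplacian_matrix G vs $$ (i, j) = cnj (laplacian_matrix G vs $$ (j, i))"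
    if "i < length vs" "j < length vs" for i j
    using that simple_graphD(4)[OF G, of "vs ! i" "vs ! j"] by (simp add: laplacian_matrix_index)
  from kernel_dim_hermitian[OF laplacian_matrix_carrier this \<mu>] show ?thesis
    by (simp add: order_char_poly_laplacian[OF vs])
qed

text \<open>
  The only way in which multiplicities are compared below: both eigenspaces have the dimension
  that is read off from the common spectrum. The family \<open>f\<close> bounds this dimension
  from below, and evaluation on \<open>J\<close> bounds it from above.
\<close>

lemma card_independent_eigenfunctions_le:
  assumes G: "simple_graph (pverts G) (parcs G)" and T: "simple_graph (pverts T) (parcs T)"
    and cospectral: "laplacian_spectrum G = laplacian_spectrum T" and \<mu>: "cnj \<mu> = \<mu>"
    and I: "finite I" "\<And>i. i \<in> I \<Longrightarrow> eigenfunction (pverts G) (parcs G) \<mu> (f i)"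
    and indep: "\<And>c. (\<And>v. v \<in> pverts G \<Longrightarrow> (\<Sum>i\<in>I. c i * f i v) = 0) \<Longrightarrow> \<forall>i\<in>I. c i = 0"
    and J: "J \<subseteq> pverts T"
    and det: "\<And>x v. eigenfunction (pverts T) (parcs T) \<mu> x \<Longrightarrow> \<forall>j\<in>J. x j = 0 \<Longrightarrow> v \<in> pverts T \<Longrightarrow> x v = 0"
  shows "card I \<le> card J"
proof -
  obtain vs where vs: "distinct vs" "set vs = pverts G"
    using finite_distinct_list[OF simple_graphD(1)[OF G]] by blast
  obtain ws where ws: "distinct ws" "set ws = pverts T"
    using finite_distinct_list[OF simple_graphD(1)[OF T]] by blast
  let ?A = "char_matrix (laplacian_matrix G vs) \<mu>" and ?B = "char_matrix (laplacian_matrix T ws) \<mu>"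
  have A: "?A \<in> carrier_mat (length vs) (length vs)"
    using laplacian_matrix_carrier[of G vs] by simp
  have B: "?B \<in> carrier_mat (length ws) (length ws)"
    using laplacian_matrix_carrier[of T ws] by simp
  have "card I \<le> kernel_dim ?A"
  proof (rule card_independent_le_kernel_dim[OF A I(1), of "\<lambda>i. vec (length vs) (\<lambda>k. f i (vs ! k))"])
    show "vec (length vs) (\<lambda>k. f i (vs ! k)) \<in> mat_kernel ?A" if "i \<in> I" for i
      using I(2)[OF that] by (simp add: vec_in_kernel_iff_eigenfunction[OF G vs])
    show "\<forall>i\<in>I. c i = 0"
      if c: "\<And>r. r < length vs \<Longrightarrow> (\<Sum>i\<in>I. c i * vec (length vs) (\<lambda>k. f i (vs ! k)) $ r) = 0" for c
    proof (rule indep)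
      fix v assume "v \<in> pverts G"
      then obtain r where "r < length vs" "v = vs ! r" using vs(2) by (metis in_set_conv_nth)
      then show "(\<Sum>i\<in>I. c i * f i v) = 0" using c[of r] by simp
    qed
  qed
  also have "kernel_dim ?A = kernel_dim ?B"
    by (simp add: kernel_dim_laplacian[OF G vs \<mu>] kernel_dim_laplacian[OF T ws \<mu>] cospectral)
  also have "\<dots> \<le> card J"
  proof -
    define r where "r = the_inv_into {..<length ws} (nth ws)"
    have inj: "inj_on (nth ws) {..<length ws}" using ws(1) by (auto simp: inj_on_def nth_eq_iff_index_eq)
    have r: "r (ws ! k) = k" if "k < length ws" for k
      using that inj by (simp add: r_def the_inv_into_f_f)
    have nth_r: "r j < length ws \<and> ws ! r j = j" if "j \<in> pverts T" for j
      using that ws(2) r by (metis in_set_conv_nth)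
    have "card (r ` J) = card J"
      using nth_r J by (intro card_image) (metis inj_onI subsetD)
    moreover have "kernel_dim ?B \<le> card (r ` J)"
    proof (rule kernel_dim_le_card_determining[OF B])
      show "finite (r ` J)" using J simple_graphD(1)[OF T] finite_subset by blast
      show "r ` J \<subseteq> {..<length ws}" using nth_r J by auto
      fix y assume y: "y \<in> mat_kernel ?B" and y0: "\<And>j. j \<in> r ` J \<Longrightarrow> y $ j = 0"
      have yc: "y \<in> carrier_vec (length ws)" using mat_kernel_carrier[OF B] y by auto
      have "y = vec (length ws) (\<lambda>k. y $ r (ws ! k))"
        using yc r by (intro eq_vecI) auto
      then have "eigenfunction (pverts T) (parcs T) \<mu> (\<lambda>j. y $ r j)"
        using vec_in_kernel_iff_eigenfunction[OF T ws, of "\<lambda>j. y $ r j" \<mu>] y by simp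
      moreover have "\<forall>j\<in>J. y $ r j = 0" using y0 by simp
      ultimately have "y $ r v = 0" if "v \<in> pverts T" for v
        using det[of "\<lambda>j. y $ r j" v] that by simp
      then have "y $ k = 0" if "k < length ws" for k
        using r[OF that] nth_mem[OF that] ws(2) by metis
      then show "y = 0\<^sub>v (length ws)" using yc by (intro eq_vecI) auto
    qed
    ultimately show ?thesis by simp
  qed
  finally show ?thesis .
qed

text \<open>
  Otherwise the eigenfunctions of \<open>G\<close> would be determined by their values on the
  empty set.
\<close>

lemma cospectral_eigenfunction:
  assumes G: "simple_graph (pverts G) (parcs G)" and T: "simple_graph (pverts T) (parcs T)"
    and cospectral: "laplacian_spectrum G = laplacian_spectrum T" and \<mu>: "cnj \<mu> = \<mu>"
    and x: "eigenfunction (pverts T) (parcs T) \<mu> x" "v \<in> pverts T" "x v \<noteq> 0"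
  shows "\<exists>y u. eigenfunction (pverts G) (parcs G) \<mu> y \<and> u \<in> pverts G \<and> y u \<noteq> 0"
proof (rule ccontr)
  assume no: "\<not> ?thesis"
  have "card {()} \<le> card ({} :: 'a set)"
  proof (rule card_independent_eigenfunctions_le[OF T G cospectral[symmetric] \<mu>, of "{()}" "\<lambda>_. x"])
    show "\<forall>i\<in>{()}. c i = 0"
      if "\<And>v. v \<in> pverts T \<Longrightarrow> (\<Sum>i\<in>{()}. c i * x v) = 0" for c :: "unit \<Rightarrow> complex"
      using that[OF x(2)] x(3) by auto
  qed (use x no in auto)
  then show False by simp
qed

lemma card_verts_eq_size_spectrum:
  assumes G: "simple_graph (pverts G) (parcs G)"
  shows "card (pverts G) = size (laplacian_spectrum G)"
proof -
  obtain vs where vs: "distinct vs" "set vs = pverts G"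
    using finite_distinct_list[OF simple_graphD(1)[OF G]] by blast
  then show ?thesis
    using size_proots_char_poly[OF laplacian_matrix_carrier[of G vs]] distinct_card[OF vs(1)]
    by (simp add: laplacian_spectrum_eq[OF vs])
qed

text \<open>
  These are the traces of \<open>L\<close> and \<open>L\<^sup>2\<close>. A diagonal entry of
  \<open>L\<^sup>2\<close> is the squared degree plus one for each neighbour.
\<close>

lemma sum_degrees_eq_spectral:
  assumes G: "simple_graph (pverts G) (parcs G)"
  defines "d \<equiv> \<lambda>v. card (parcs G `` {v})"
  shows "of_nat (\<Sum>v\<in>pverts G. d v) = (\<Sum>e\<in>#laplacian_spectrum G. e)"
    and "of_nat (\<Sum>v\<in>pverts G. (d v)\<^sup>2 + d v) = (\<Sum>e\<in>#laplacian_spectrum G. e\<^sup>2)"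
proof -
  obtain vs where vs: "distinct vs" "set vs = pverts G"
    using finite_distinct_list[OF simple_graphD(1)[OF G]] by blast
  let ?L = "laplacian_matrix G vs" and ?n = "length vs"
  note L = laplacian_matrix_carrier[of G vs]
  have "(\<Sum>i<?n. ?L $$ (i, i)) = (\<Sum>i<?n. of_nat (d (vs ! i)))"
    using simple_graphD(5)[OF G] by (intro sum.cong) (auto simp: laplacian_matrix_index d_def)
  then show "of_nat (\<Sum>v\<in>pverts G. d v) = (\<Sum>e\<in>#laplacian_spectrum G. e)"
    using trace_eq_sum_proots(1)[OF L] sum_nth_eq_sum_set[OF vs(1), of "\<lambda>v. complex_of_nat (d v)"] vs
    by (simp add: laplacian_spectrum_eq[OF vs])
  have "(?L * ?L) $$ (i, i) = of_nat ((d (vs ! i))\<^sup>2 + d (vs ! i))" if i: "i < ?n" for i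
  proof -
    let ?v = "vs ! i"
    have "(?L * ?L) $$ (i, i) = (\<Sum>k<?n. ?L $$ (i, k) * ?L $$ (k, i))"
      using L i by (auto simp: scalar_prod_def atLeast0LessThan)
    also have "\<dots> = (\<Sum>k<?n. (if i = k then (of_nat (d ?v))\<^sup>2 else 0)
        + (if (?v, vs ! k) \<in> parcs G then 1 else 0))"
      using simple_graphD(4,5)[OF G]
      by (intro sum.cong refl) (auto simp: laplacian_matrix_index i d_def power2_eq_square)
    also have "\<dots> = (of_nat (d ?v))\<^sup>2 + (\<Sum>k<?n. if (?v, vs ! k) \<in> parcs G then 1 else 0)"
      using i by (simp add: sum.distrib)
    also have "(\<Sum>k<?n. if (?v, vs ! k) \<in> parcs G then 1 else 0)
        = (\<Sum>u\<in>set vs. if (?v, u) \<in> parcs G then 1 else (0 :: complex))"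
      by (rule sum_nth_eq_sum_set[OF vs(1), of "\<lambda>u. if (?v, u) \<in> parcs G then 1 else 0"])
    also have "\<dots> = (\<Sum>u\<in>parcs G `` {?v}. 1)"
      using simple_graphD(1,3)[OF G] by (intro sum.mono_neutral_cong_right) (auto simp: vs)
    finally show ?thesis by (simp add: d_def)
  qed
  then have "(\<Sum>i<?n. (?L * ?L) $$ (i, i)) = (\<Sum>i<?n. of_nat ((d (vs ! i))\<^sup>2 + d (vs ! i)))"
    by (intro sum.cong refl) simp
  then show "of_nat (\<Sum>v\<in>pverts G. (d v)\<^sup>2 + d v) = (\<Sum>e\<in>#laplacian_spectrum G. e\<^sup>2)"
    using trace_eq_sum_proots(2)[OF L] sum_nth_eq_sum_set[OF vs(1), of "\<lambda>v. complex_of_nat ((d v)\<^sup>2 + d v)"] vs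
    by (simp add: laplacian_spectrum_eq[OF vs])
qed

section \<open>Harmonic functions, components and complements\<close>

lemma sum_edges:
  assumes "simple_graph V E"
  shows "(\<Sum>v\<in>V. \<Sum>u\<in>E `` {v}. h v u) = (\<Sum>(v, u)\<in>E. h v u)"
proof -
  have "(SIGMA v:V. E `` {v}) = E" using simple_graphD(6)[OF assms] by auto
  then show ?thesis
    using simple_graphD(1,2)[OF assms] sum.Sigma[of V "\<lambda>v. E `` {v}" h] by simp
qed

lemma sum_edges_swap:
  assumes "simple_graph V E"
  shows "(\<Sum>(v, u)\<in>E. h v u) = (\<Sum>(v, u)\<in>E. h u v)"
proof -
  have "prod.swap ` E = E" using simple_graphD(4)[OF assms] by force
  then show ?thesis
    using sum.reindex[of prod.swap E "\<lambda>(v, u). h v u"] by (simp add: case_prod_unfold comp_def)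
qed

lemma sum_mult_lap:
  assumes "simple_graph V E"
  shows "(\<Sum>v\<in>V. g v * lap E x v) = (\<Sum>(v, u)\<in>E. g v * (x v - x u))"
  using sum_edges[OF assms, of "\<lambda>v u. g v * (x v - x u)"] by (simp add: lap_def sum_distrib_left)

lemma sum_lap_eq_0:
  assumes "simple_graph V E"
  shows "(\<Sum>v\<in>V. lap E x v) = 0"
proof -
  let ?S = "\<Sum>(v, u)\<in>E. x v - x u"
  have "?S = (\<Sum>(v, u)\<in>E. x u - x v)" by (rule sum_edges_swap[OF assms])
  also have "\<dots> = - ?S" by (simp add: case_prod_unfold flip: sum_negf)
  finally have "2 * ?S = 0" by (metis mult_2 add.right_inverse)
  then have "?S = 0" by simp
  then show ?thesis using sum_mult_lap[OF assms, of "\<lambda>_. 1" x] by simp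
qed

text \<open>
  The sum of \<open>lap E x\<close> vanishes because the two orientations of an edge cancel.
\<close>

lemma sum_eigenfunction_eq_0:
  assumes "simple_graph V E" "eigenfunction V E \<mu> x" "\<mu> \<noteq> 0"
  shows "(\<Sum>v\<in>V. x v) = 0"
proof -
  have "(\<Sum>v\<in>V. lap E x v) = (\<Sum>v\<in>V. \<mu> * x v)"
    using assms(2) by (simp add: eigenfunction_def)
  also have "\<dots> = \<mu> * (\<Sum>v\<in>V. x v)" by (simp add: sum_distrib_left)
  finally show ?thesis using sum_lap_eq_0[OF assms(1), of x] assms(3) by simp
qed

text \<open>
  The Dirichlet energy of a harmonic function, the sum of
  \<open>\<bar>x v - x u\<bar>\<^sup>2\<close> over the edges, is zero.
\<close>

lemma harmonic_adjacent_eq: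
  assumes G: "simple_graph V E" and harm: "eigenfunction V E 0 x" and uv: "(u, v) \<in> E"
  shows "x u = x v"
proof -
  have "0 = (\<Sum>v\<in>V. cnj (x v) * lap E x v)" using harm by (simp add: eigenfunction_def)
  also have "\<dots> = (\<Sum>(v, u)\<in>E. cnj (x v) * (x v - x u))" by (rule sum_mult_lap[OF G])
  finally have 1: "(\<Sum>(v, u)\<in>E. cnj (x v) * (x v - x u)) = 0" by simp
  then have 2: "(\<Sum>(v, u)\<in>E. cnj (x u) * (x u - x v)) = 0"
    using sum_edges_swap[OF G, of "\<lambda>v u. cnj (x v) * (x v - x u)"] by simp
  have "complex_of_real (\<Sum>(v, u)\<in>E. (cmod (x v - x u))\<^sup>2)
      = (\<Sum>(v, u)\<in>E. (x v - x u) * cnj (x v - x u))"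
    by (simp add: case_prod_unfold complex_norm_square del: complex_cnj_diff of_real_power)
  also have "\<dots> = (\<Sum>(v, u)\<in>E. cnj (x v) * (x v - x u)) + (\<Sum>(v, u)\<in>E. cnj (x u) * (x u - x v))"
    by (simp add: case_prod_unfold algebra_simps flip: sum.distrib)
  finally have "complex_of_real (\<Sum>(v, u)\<in>E. (cmod (x v - x u))\<^sup>2) = 0" using 1 2 by simp
  then have "(\<Sum>(v, u)\<in>E. (cmod (x v - x u))\<^sup>2) = 0" by (simp only: of_real_eq_0_iff)
  then have "\<forall>e\<in>E. (case e of (v, u) \<Rightarrow> (cmod (x v - x u))\<^sup>2) = 0"
    using simple_graphD(8)[OF G] by (subst (asm) sum_nonneg_eq_0_iff) auto
  then show ?thesis using uv by auto
qed

definition components :: "'a set \<Rightarrow> ('a \<times> 'a) set \<Rightarrow> 'a set set" where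
  "components V E = V // {(u, v). u \<in> V \<and> v \<in> V \<and> (u, v) \<in> E\<^sup>*}"

lemma equiv_reachable:
  assumes "simple_graph V E"
  shows "equiv V {(u, v). u \<in> V \<and> v \<in> V \<and> (u, v) \<in> E\<^sup>*}"
proof (rule equivI)
  have "sym (E\<^sup>*)" using assms by (simp add: simple_graph_def sym_rtrancl)
  then show "sym {(u, v). u \<in> V \<and> v \<in> V \<and> (u, v) \<in> E\<^sup>*}" by (auto simp: sym_def)
  show "trans {(u, v). u \<in> V \<and> v \<in> V \<and> (u, v) \<in> E\<^sup>*}"
    by (auto simp: trans_def intro: rtrancl_trans)
qed (auto simp: refl_on_def)

lemma componentsD:
  assumes G: "simple_graph V E"
  shows "finite (components V E)" "\<Union>(components V E) = V"
    "C \<in> components V E \<Longrightarrow> C \<noteq> {}" "C \<in> components V E \<Longrightarrow> C \<subseteq> V"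
    "C \<in> components V E \<Longrightarrow> C' \<in> components V E \<Longrightarrow> C \<noteq> C' \<Longrightarrow> C \<inter> C' = {}"
    "C \<in> components V E \<Longrightarrow> u \<in> C \<Longrightarrow> v \<in> C \<Longrightarrow> (u, v) \<in> E\<^sup>*"
    "C \<in> components V E \<Longrightarrow> E `` C \<subseteq> C"
proof -
  note eq = equiv_reachable[OF G]
  show fin: "finite (components V E)"
    unfolding components_def using simple_graphD(1)[OF G] by (intro finite_quotient) auto
  show un: "\<Union>(components V E) = V" unfolding components_def by (rule Union_quotient[OF eq])
  show "C \<noteq> {}" if "C \<in> components V E" for C
    using that in_quotient_imp_non_empty[OF eq] by (auto simp: components_def)
  show "C \<subseteq> V" if "C \<in> components V E" for C using un that by auto
  show "C \<inter> C' = {}" if "C \<in> components V E" "C' \<in> components V E" "C \<noteq> C'" for C C'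
    using quotient_disj[OF eq, of C C'] that by (auto simp: components_def)
  show "(u, v) \<in> E\<^sup>*" if "C \<in> components V E" "u \<in> C" "v \<in> C" for C u v
    using in_quotient_imp_in_rel[OF eq, of C u v] that by (auto simp: components_def)
  show "E `` C \<subseteq> C" if C: "C \<in> components V E" for C
  proof safe
    fix u v assume "u \<in> C" "(u, v) \<in> E"
    then show "v \<in> C"
      using in_quotient_imp_closed[OF eq, of C u v] C simple_graphD(6,7)[OF G, of u v]
      by (auto simp: components_def)
  qed
qed

lemma sum_over_components:
  assumes G: "simple_graph V E"
  shows "(\<Sum>v\<in>V. h v) = (\<Sum>C\<in>components V E. \<Sum>v\<in>C. h v)"
proof -
  have "\<And>C. C \<in> components V E \<Longrightarrow> finite C"
    using componentsD(4)[OF G] simple_graphD(1)[OF G] finite_subset by blast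
  then show ?thesis
    using sum.Union_disjoint[of "components V E" h] componentsD(2,5)[OF G] by auto
qed

lemma card_components_sum:
  assumes "simple_graph V E"
  shows "card V = (\<Sum>C\<in>components V E. card C)"
  using sum_over_components[OF assms, of "\<lambda>_. 1 :: nat"] by simp

lemma constant_on_component:
  assumes "simple_graph V E" "\<And>u v. (u, v) \<in> E \<Longrightarrow> x u = x v"
    and "C \<in> components V E" "u \<in> C" "v \<in> C"
  shows "x u = x v"
proof -
  have "(u, v) \<in> E\<^sup>*" using componentsD(6)[OF assms(1,3)] assms(4,5) .
  then show ?thesis by induction (auto dest: assms(2))
qed

lemma lap_indicator_component:
  assumes G: "simple_graph V E" and C: "C \<in> components V E"
  shows "lap E (\<lambda>u. if u \<in> C then f u else 0) v = (if v \<in> C then lap E f v else 0)"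
proof -
  have "u \<in> C \<longleftrightarrow> v \<in> C" if "(v, u) \<in> E" for u
    using componentsD(7)[OF G C] that simple_graphD(4)[OF G, of u v] by auto
  then show ?thesis by (auto simp: lap_def intro!: sum.cong)
qed

lemma sum_lap_component_eq_0:
  assumes G: "simple_graph V E" and C: "C \<in> components V E"
  shows "(\<Sum>v\<in>C. lap E f v) = 0"
proof -
  have "(\<Sum>v\<in>C. lap E f v) = (\<Sum>v\<in>V. if v \<in> C then lap E f v else 0)"
    using componentsD(4)[OF G C] simple_graphD(1)[OF G]
    by (intro sum.mono_neutral_cong_left) auto
  then show ?thesis
    using sum_lap_eq_0[OF G, of "\<lambda>u. if u \<in> C then f u else 0"]
    by (simp add: lap_indicator_component[OF G C])
qed

text \<open>
  A harmonic function is constant on each component, and its value on one component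
  \<open>C0\<close> follows from the others when the total sum is zero. So one vertex from each
  component except \<open>C0\<close> suffices.
\<close>

lemma components_determining_set:
  assumes G: "simple_graph V F" and C0: "C0 \<in> components V F"
  shows "\<exists>J\<subseteq>V. card J \<le> card (components V F) - 1 \<and>
    (\<forall>x v. eigenfunction V F 0 x \<longrightarrow> (\<Sum>v\<in>V. x v) = 0 \<longrightarrow> (\<forall>j\<in>J. x j = 0) \<longrightarrow> v \<in> V \<longrightarrow> x v = 0)"
proof -
  define r where "r C = (SOME v. v \<in> C)" for C :: "'a set"
  have r: "r C \<in> C" if "C \<in> components V F" for C
    unfolding r_def using componentsD(3)[OF G that] by (simp add: some_in_eq)
  let ?Q = "components V F - {C0}"
  have fin: "finite (components V F)" by (rule componentsD(1)[OF G])
  have "r ` ?Q \<subseteq> V" using r componentsD(4)[OF G] by blast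
  moreover have "card (r ` ?Q) \<le> card (components V F) - 1"
    using card_image_le[of ?Q r] fin C0 by simp
  moreover have "x v = 0"
    if x: "eigenfunction V F 0 x" "(\<Sum>v\<in>V. x v) = 0" "\<forall>j\<in>r ` ?Q. x j = 0" and v: "v \<in> V" for x v
  proof -
    have const: "x u = x v" if "C \<in> components V F" "u \<in> C" "v \<in> C" for C u v
      by (rule constant_on_component[OF G harmonic_adjacent_eq[OF G x(1)] that])
    have zero: "x u = 0" if "C \<in> ?Q" "u \<in> C" for C u
      using const[of C u "r C"] r[of C] that x(3) by auto
    have "(\<Sum>C\<in>?Q. \<Sum>v\<in>C. x v) = 0" using zero by (intro sum.neutral ballI)
    then have s0: "(\<Sum>v\<in>C0. x v) = 0"
      using x(2) sum_over_components[OF G, of x] sum.remove[OF fin C0, of "\<lambda>C. \<Sum>v\<in>C. x v"] by simp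
    have "x u = 0" if "u \<in> C0" for u
    proof -
      have "(\<Sum>v\<in>C0. x v) = of_nat (card C0) * x u"
        using const[OF C0 _ that] by simp
      moreover have "finite C0"
        by (rule finite_subset[OF componentsD(4)[OF G C0] simple_graphD(1)[OF G]])
      then have "card C0 \<noteq> 0" using that by auto
      ultimately show ?thesis using s0 by simp
    qed
    moreover obtain C where "C \<in> components V F" "v \<in> C"
      using v componentsD(2)[OF G] by (metis UnionE)
    ultimately show "x v = 0" using zero[of C v] by (cases "C = C0") simp_all
  qed
  ultimately show ?thesis by (intro exI[of _ "r ` ?Q"]) blast
qed

definition complement_edges :: "'a set \<Rightarrow> ('a \<times> 'a) set \<Rightarrow> ('a \<times> 'a) set" where
  "complement_edges V E = {(u, v). u \<in> V \<and> v \<in> V \<and> u \<noteq> v \<and> (u, v) \<notin> E}"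

lemma simple_graph_complement:
  assumes "simple_graph V E"
  shows "simple_graph V (complement_edges V E)"
  using assms by (auto simp: simple_graph_def complement_edges_def sym_def irrefl_def)

text \<open>
  The Laplacians of a graph and of its complement add up to the Laplacian of the complete graph.
\<close>

lemma lap_complement:
  assumes G: "simple_graph V E" and v: "v \<in> V"
  shows "lap (complement_edges V E) x v = of_nat (card V) * x v - (\<Sum>u\<in>V. x u) - lap E x v"
proof -
  let ?F = "complement_edges V E"
  have V: "V = insert v (E `` {v} \<union> ?F `` {v})"
    using v simple_graphD(3,7)[OF G] by (auto simp: complement_edges_def)
  have "v \<notin> E `` {v} \<union> ?F `` {v}" "E `` {v} \<inter> ?F `` {v} = {}"
    using simple_graphD(5)[OF G] by (auto simp: complement_edges_def)
  moreover have "finite (?F `` {v})" "finite (E `` {v})"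
    using simple_graphD(2)[OF simple_graph_complement[OF G]] simple_graphD(2)[OF G] by auto
  ultimately have "(\<Sum>u\<in>insert v (E `` {v} \<union> ?F `` {v}). x v - x u) = lap E x v + lap ?F x v"
    by (simp add: lap_def sum.union_disjoint)
  then have "(\<Sum>u\<in>V. x v - x u) = lap E x v + lap ?F x v" using V by simp
  then show ?thesis by (simp add: sum_subtractf algebra_simps)
qed

text \<open>
  A maximum principle. On a component \<open>D\<close> the eigenfunction has sum zero, so its real
  (or imaginary) part \<open>z\<close> has a positive maximum \<open>z v\<close>. All differences
  \<open>z v - z u\<close> are nonnegative, hence \<open>p * z v\<close>, their sum over the
  neighbours of \<open>v\<close>, is at most their sum over \<open>D\<close>, which is
  \<open>card D * z v\<close>.
\<close>

lemma eigenvalue_le_card_component: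
  fixes p :: nat
  assumes G: "simple_graph V F" and p: "p > 0"
    and ev: "eigenfunction V F (of_nat p) x" and v0: "v0 \<in> V" "x v0 \<noteq> 0"
  shows "\<exists>D\<in>components V F. p \<le> card D"
proof -
  \<comment> \<open>\<open>p\<close> is real, so the real and the imaginary part are eigenfunctions as well,
    and one of them is nonzero at \<open>v0\<close>.\<close>
  define z where "z = (if Re (x v0) \<noteq> 0 then Re \<circ> x else Im \<circ> x)"
  have z0: "z v0 \<noteq> 0" using v0(2) by (auto simp: z_def complex_eq_iff)
  have lapz: "(\<Sum>u\<in>F `` {v}. z v - z u) = p * z v" if "v \<in> V" for v
  proof -
    have eq: "(\<Sum>u\<in>F `` {v}. x v - x u) = of_nat p * x v"
      using ev that by (simp add: eigenfunction_def lap_def)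
    show ?thesis using arg_cong[OF eq, of Re] arg_cong[OF eq, of Im] by (simp add: z_def)
  qed
  obtain D where D: "D \<in> components V F" "v0 \<in> D" using componentsD(2)[OF G] v0(1) by blast
  have DV: "D \<subseteq> V" and fin: "finite D"
    using componentsD(4)[OF G D(1)] simple_graphD(1)[OF G] finite_subset by auto
  have sum0: "(\<Sum>v\<in>D. z v) = 0"
  proof -
    have "of_nat p * (\<Sum>v\<in>D. x v) = (\<Sum>v\<in>D. lap F x v)"
      using ev DV by (auto simp: eigenfunction_def sum_distrib_left intro!: sum.cong)
    then have "(\<Sum>v\<in>D. x v) = 0" using sum_lap_component_eq_0[OF G D(1)] p by simp
    from arg_cong[OF this, of Re] arg_cong[OF this, of Im] show ?thesis by (simp add: z_def)
  qed
  have "D \<noteq> {}" using D by auto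
  then have "Max (z ` D) \<in> z ` D" using fin by simp
  then obtain v where v: "v \<in> D" "z v = Max (z ` D)" by auto
  then have max: "z u \<le> z v" if "u \<in> D" for u using fin that by simp
  have "z v > 0"
  proof (rule ccontr)
    assume "\<not> z v > 0"
    then have "\<forall>u\<in>D. - z u \<ge> 0" using max by force
    moreover have "(\<Sum>u\<in>D. - z u) = 0" using sum0 by (simp add: sum_negf)
    ultimately have "\<forall>u\<in>D. - z u = 0" using fin by (subst (asm) sum_nonneg_eq_0_iff) auto
    then show False using z0 D by auto
  qed
  have "p * z v = (\<Sum>u\<in>F `` {v}. z v - z u)" using lapz v(1) DV by auto
  also have "\<dots> \<le> (\<Sum>u\<in>D. z v - z u)"
    using componentsD(7)[OF G D(1)] v(1) max fin by (intro sum_mono2) auto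
  also have "\<dots> = card D * z v" using sum0 by (simp add: sum_subtractf)
  finally have "p \<le> card D" using \<open>z v > 0\<close> by simp
  then show ?thesis using D(1) by blast
qed

section \<open>Cycles in two-regular graphs\<close>

text \<open>
  \<open>C\<close> is enumerated cyclically by \<open>s\<close> in such a way that the neighbours
  of a vertex are its predecessor and its successor. Equality of the neighbour sets makes
  \<open>C\<close> a whole component.
\<close>

definition cycle_on :: "('a \<times> 'a) set \<Rightarrow> 'a set \<Rightarrow> (nat \<Rightarrow> 'a) \<Rightarrow> nat \<Rightarrow> bool" where
  "cycle_on H C s l \<longleftrightarrow> 3 \<le> l \<and> bij_betw s {..<l} C
    \<and> (\<forall>i<l. H `` {s i} = {s (Suc i mod l), s ((i + l - 1) mod l)})"

text \<open>
  A walk that never turns back visits, at its first repetition, the vertex where it started: a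
  repetition \<open>s l = s i\<close> with \<open>i > 0\<close> would give the vertex
  \<open>s i\<close> a third neighbour.
\<close>

lemma two_regular_component_cycle:
  assumes H: "simple_graph D H" and reg: "\<And>v. v \<in> D \<Longrightarrow> card (H `` {v}) = 2"
    and C: "C \<in> components D H"
  shows "\<exists>s l. cycle_on H C s l"
proof -
  obtain v0 where v0: "v0 \<in> C" "v0 \<in> D" using componentsD(3,4)[OF H C] by blast
  have "H `` {v0} \<noteq> {}" using reg[OF v0(2)] by auto
  then obtain v1 where v1: "(v0, v1) \<in> H" by auto
  define next_vertex where "next_vertex u v = (SOME t. (v, t) \<in> H \<and> t \<noteq> u)" for u v
  have nv: "(v, next_vertex u v) \<in> H \<and> next_vertex u v \<noteq> u" if "v \<in> D" for u v
  proof -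
    have "\<not> H `` {v} \<subseteq> {u}" using reg[OF that] card_mono[of "{u}" "H `` {v}"] by auto
    then have "\<exists>t. (v, t) \<in> H \<and> t \<noteq> u" by auto
    then show ?thesis unfolding next_vertex_def by (rule someI_ex)
  qed
  \<comment> \<open>The state of the walk is the directed edge that it is about to traverse.\<close>
  define a where "a k = ((\<lambda>(u, v). (v, next_vertex u v)) ^^ k) (v0, v1)" for k
  define s where "s k = fst (a k)" for k
  have a: "a k = (s k, s (Suc k)) \<and> s (Suc (Suc k)) = next_vertex (s k) (s (Suc k))" for k
    by (induction k) (auto simp: a_def s_def split: prod.splits)
  have edge: "(s k, s (Suc k)) \<in> H" for k
  proof (induction k)
    case 0
    then show ?case using v1 by (simp add: s_def a_def)
  next
    case (Suc k)
    then show ?case using a[of k] nv[of "s (Suc k)" "s k"] simple_graphD(7)[OF H] by metis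
  qed
  have inD: "s k \<in> D" for k using simple_graphD(6)[OF H edge] .
  have no_backtrack: "s (Suc (Suc k)) \<noteq> s k" for k
    using a[of k] nv[OF inD[of "Suc k"], of "s k"] by simp
  have nbrs: "H `` {v} = {p, q}" if "(v, p) \<in> H" "(v, q) \<in> H" "p \<noteq> q" for v p q
  proof -
    have "v \<in> D" using simple_graphD(6)[OF H that(1)] .
    then have "card {p, q} = card (H `` {v})" using reg that(3) by simp
    then show ?thesis using that simple_graphD(2)[OF H, of "{v}"]
      by (intro card_subset_eq[symmetric]) auto
  qed
  have nbrs_Suc: "H `` {s (Suc k)} = {s k, s (Suc (Suc k))}" for k
    using edge[of k] edge[of "Suc k"] no_backtrack[of k] simple_graphD(4)[OF H, of "s k"]
    by (intro nbrs) auto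
  have "\<not> inj s"
  proof
    assume "inj s"
    moreover have "finite (range s)"
      using inD by (intro finite_subset[OF _ simple_graphD(1)[OF H]]) auto
    ultimately show False using finite_imageD[of s UNIV] by simp
  qed
  then have "\<exists>j. \<exists>i<j. s i = s j" by (metis injI linorder_neqE_nat)
  define l where "l = (LEAST j. \<exists>i<j. s i = s j)"
  obtain i where i: "i < l" "s i = s l"
    using LeastI_ex[OF \<open>\<exists>j. \<exists>i<j. s i = s j\<close>] unfolding l_def by blast
  have inj: "inj_on s {..<l}"
  proof (rule linorder_inj_onI)
    fix p q assume "p < q" "p \<in> {..<l}" "q \<in> {..<l}"
    then show "s p \<noteq> s q" using not_less_Least[of q "\<lambda>j. \<exists>i<j. s i = s j"] unfolding l_def by auto
  qed auto
  obtain l' where l': "l = Suc l'" using i(1) by (cases l) auto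
  \<comment> \<open>Otherwise \<open>s l'\<close>, the last vertex before the repetition, would be \<open>s (i - 1)\<close> or \<open>s (i + 1)\<close>,
    an earlier repetition or a step back.\<close>
  have "i = 0"
  proof (rule ccontr)
    assume "i \<noteq> 0"
    then obtain k where k: "i = Suc k" by (cases i) auto
    have "(s i, s l') \<in> H" using edge[of l'] simple_graphD(4)[OF H] i(2) l' by simp
    then have "s l' = s k \<or> s l' = s (Suc i)" using nbrs_Suc[of k] k by auto
    then show False
    proof
      assume "s l' = s k"
      then show False using inj_onD[OF inj, of l' k] i(1) k l' by auto
    next
      assume eq: "s l' = s (Suc i)"
      show False
      proof (cases "Suc i = l")
        case True
        then show False using eq edge[of l'] simple_graphD(5)[OF H] l' by metis
      next
        case False
        then have "l' = Suc i" using inj_onD[OF inj eq] i(1) l' by auto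
        then show False using no_backtrack[of i] i(2) l' by simp
      qed
    qed
  qed
  then have sl: "s l = s 0" using i by simp
  have "l \<noteq> 1" using edge[of 0] sl simple_graphD(5)[OF H] by auto
  moreover have "l \<noteq> 2" using no_backtrack[of 0] sl by (auto simp: numeral_2_eq_2)
  ultimately have l3: "3 \<le> l" using l' by auto
  have nb: "H `` {s k} = {s (Suc k mod l), s ((k + l - 1) mod l)}" if "k < l" for k
  proof (cases k)
    case 0
    have "s l' \<noteq> s 1" using inj_onD[OF inj, of l' 1] l' l3 by auto
    moreover have "(s 0, s l') \<in> H" using edge[of l'] simple_graphD(4)[OF H] sl l' by simp
    ultimately have "H `` {s 0} = {s 1, s l'}" using edge[of 0] by (intro nbrs) auto
    then show ?thesis using 0 l3 l' by simp
  next
    case (Suc k')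
    have "s (Suc k) = s (Suc k mod l)" using sl that by (cases "Suc k = l") auto
    moreover have "(k + l - 1) mod l = k'" using Suc that by simp
    ultimately show ?thesis using nbrs_Suc[of k'] Suc by auto
  qed
  have "s ` {..<l} = C"
  proof
    have "s k \<in> C" for k
    proof (induction k)
      case 0
      then show ?case using v0 by (simp add: s_def a_def)
    next
      case (Suc k)
      then show ?case using edge[of k] componentsD(7)[OF H C] by auto
    qed
    then show "s ` {..<l} \<subseteq> C" by auto
    show "C \<subseteq> s ` {..<l}"
    proof
      fix v assume "v \<in> C"
      then have "(v0, v) \<in> H\<^sup>*" using componentsD(6)[OF H C] v0 by simp
      then show "v \<in> s ` {..<l}"
      proof induction
        case base
        then show ?case using l3 by (intro image_eqI[of _ _ 0]) (auto simp: s_def a_def)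
      next
        case (step y z)
        then obtain k where "k < l" "y = s k" by auto
        then have "z = s (Suc k mod l) \<or> z = s ((k + l - 1) mod l)" using nb[of k] step(2) by auto
        then obtain q where "q < l" "z = s q" using l3 by (metis mod_less_divisor not_numeral_le_zero gr0I)
        then show ?case by simp
      qed
    qed
  qed
  then show ?thesis using l3 inj nb by (auto simp: cycle_on_def bij_betw_def)
qed

lemma lap_cycle:
  assumes c: "cycle_on H C s l" and i: "i < l"
  shows "lap H x (s i) = 2 * x (s i) - x (s (Suc i mod l)) - x (s ((i + l - 1) mod l))"
proof -
  have l: "3 \<le> l" and inj: "inj_on s {..<l}" using c by (auto simp: cycle_on_def bij_betw_def)
  have "Suc i mod l \<noteq> (i + l - 1) mod l"
    using i l by (cases i; cases "Suc i = l") (auto simp: mod_if)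
  then have "s (Suc i mod l) \<noteq> s ((i + l - 1) mod l)"
    using inj_onD[OF inj, of "Suc i mod l" "(i + l - 1) mod l"] l by auto
  then show ?thesis using c i by (simp add: lap_def cycle_on_def)
qed

lemma power_mod_order:
  fixes z :: complex
  assumes "z ^ l = 1"
  shows "z ^ (k mod l) = z ^ k"
proof -
  have "z ^ k = z ^ (l * (k div l) + k mod l)" by simp
  also have "\<dots> = z ^ (k mod l)" by (simp only: power_add power_mult assms) simp
  finally show ?thesis by simp
qed

text \<open>
  The function \<open>s i \<mapsto> z ^ i\<close> is well defined on the cycle because
  \<open>z ^ l = 1\<close>. Outside of the cycle it is extended by zero.
\<close>

lemma cycle_eigenfunction:
  assumes H: "simple_graph D H" and C: "C \<in> components D H" and c: "cycle_on H C s l"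
    and z: "z ^ l = 1"
  shows "\<exists>x. eigenfunction D H (2 - z - 1 / z) x \<and> x (s 0) = 1"
proof -
  have l: "3 \<le> l" and inj: "inj_on s {..<l}" and im: "s ` {..<l} = C"
    using c by (auto simp: cycle_on_def bij_betw_def)
  have z0: "z \<noteq> 0" using z l by (auto simp: power_0_left)
  define f where "f v = z ^ the_inv_into {..<l} s v" for v
  have f: "f (s i) = z ^ i" if "i < l" for i
    using the_inv_into_f_f[OF inj] that by (simp add: f_def)
  have "lap H f v = (2 - z - 1 / z) * f v" if v: "v \<in> C" for v
  proof -
    obtain i where i: "i < l" "v = s i" using v im by auto
    have "z * z ^ (i + l - 1) = z ^ (i + l)" using l by (subst power_Suc[symmetric]) simp
    then have "z ^ (i + l - 1) = z ^ i / z" using z z0 by (simp add: power_add field_simps)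
    moreover have "f (s (Suc i mod l)) = z ^ Suc i" "f (s ((i + l - 1) mod l)) = z ^ (i + l - 1)"
      using l by (simp_all add: f power_mod_order[OF z])
    ultimately have "lap H f v = 2 * z ^ i - z * z ^ i - z ^ i / z"
      using lap_cycle[OF c i(1), of f] i by (simp add: f)
    also have "\<dots> = (2 - z - 1 / z) * f v" using i by (simp add: f algebra_simps)
    finally show ?thesis .
  qed
  then have "eigenfunction D H (2 - z - 1 / z) (\<lambda>v. if v \<in> C then f v else 0)"
    by (simp add: eigenfunction_def lap_indicator_component[OF H C])
  moreover have "s 0 \<in> C" "f (s 0) = 1" using l im f[of 0] by auto
  ultimately show ?thesis by (intro exI[of _ "\<lambda>v. if v \<in> C then f v else 0"]) simp
qed

text \<open>
  Along the cycle, \<open>x\<close> gives an \<open>n\<close>-periodic sequence \<open>y\<close>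
  with \<open>y (k+2) + y k = (z + 1/z) * y (k+1)\<close>. The differences
  \<open>d k = y (k+1) - z * y k\<close> form a geometric sequence with ratio \<open>1/z\<close>.
  If \<open>d\<close> is nonzero, its periodicity gives \<open>z ^ n = 1\<close>. If
  \<open>d\<close> is zero, then \<open>y\<close> itself is geometric with ratio \<open>z\<close>.
\<close>

lemma cycle_eigenvalue_root_of_unity:
  assumes c: "cycle_on H C s n" and z: "z \<noteq> 0"
    and ev: "\<And>v. v \<in> C \<Longrightarrow> lap H x v = (2 - z - 1 / z) * x v"
    and nz: "v \<in> C" "x v \<noteq> 0"
  shows "z ^ n = 1"
proof -
  have n: "3 \<le> n" and im: "s ` {..<n} = C"
    using c by (auto simp: cycle_on_def bij_betw_def)
  define y where "y k = x (s (k mod n))" for k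
  have yn: "y n = y 0" "y (Suc n) = y 1" by (simp_all add: y_def mod_Suc)
  have rec: "y (Suc (Suc k)) + y k = (z + 1 / z) * y (Suc k)" for k
  proof -
    let ?i = "Suc k mod n"
    have i: "?i < n" using n by simp
    have "Suc ?i mod n = Suc (Suc k) mod n" by (simp add: mod_Suc_eq)
    moreover have "(?i + n - 1) mod n = k mod n"
    proof -
      have "?i + n - 1 = ?i + (n - 1)" using n by simp
      then have "(?i + n - 1) mod n = (Suc k + (n - 1)) mod n" by (simp add: mod_add_left_eq)
      also have "Suc k + (n - 1) = k + n" using n by simp
      finally show ?thesis by simp
    qed
    ultimately have "2 * y (Suc k) - y (Suc (Suc k)) - y k = (2 - z - 1 / z) * y (Suc k)"
      using lap_cycle[OF c i, of x] ev[of "s ?i"] i im by (auto simp: y_def)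
    then show ?thesis by (simp add: algebra_simps)
  qed
  define d where "d k = y (Suc k) - z * y k" for k
  have "z * d (Suc k) = d k" for k
  proof -
    have "z * d (Suc k) = z * (y (Suc (Suc k)) + y k) - z * z * y (Suc k) - z * y k"
      by (simp add: d_def algebra_simps)
    also have "\<dots> = d k" unfolding rec using z by (simp add: d_def field_simps)
    finally show ?thesis .
  qed
  then have step: "z ^ Suc k * d (Suc k) = z ^ k * d k" for k by (simp add: mult.commute mult.left_commute)
  have d: "z ^ k * d k = d 0" for k by (induction k) (simp_all only: step, simp)
  show ?thesis
  proof (cases "d 0 = 0")
    case False
    moreover have "d n = d 0" using yn by (simp add: d_def)
    ultimately show ?thesis using d[of n] by simp
  next
    case True
    then have "d k = 0" for k using d[of k] z by simp
    then have "y (Suc k) = z * y k" for k by (simp add: d_def)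
    then have yk: "y k = z ^ k * y 0" for k by (induction k) auto
    obtain k where "k < n" "v = s k" using nz(1) im by auto
    then have "y k \<noteq> 0" using nz(2) by (simp add: y_def)
    then have "y 0 \<noteq> 0" using yk[of k] by auto
    then show ?thesis using yk[of n] yn(1) by simp
  qed
qed

lemma cis_root_of_unity:
  fixes l :: nat
  assumes "0 < l"
  defines "z \<equiv> cis (2 * pi / l)"
  shows "z ^ l = 1" "z ^ k = 1 \<Longrightarrow> l dvd k"
proof -
  have pw: "z ^ k = cis (real k * (2 * pi / l))" for k by (simp add: z_def DeMoivre)
  show "z ^ l = 1" using assms(1) by (simp add: pw cis.ctr complex_eq_iff)
  assume "z ^ k = 1"
  then have "cos (real k * (2 * pi / l)) = 1" by (simp add: pw complex_eq_iff)
  then obtain j :: int where "real k * (2 * pi / l) = of_int j * 2 * pi"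
    using cos_one_2pi_int by blast
  then have "real k = real_of_int j * real l" using assms(1) by (simp add: field_simps)
  then have "int k = j * int l" by (metis of_int_eq_iff of_int_mult of_int_of_nat_eq)
  then show "l dvd k" by (metis dvd_triv_right int_dvd_int_iff)
qed

section \<open>Joins with dominating vertices\<close>

text \<open>
  \<open>E\<close> is the join of a complete graph on \<open>S\<close> with the graph that it
  induces on \<open>D\<close>.
\<close>

definition dominating_join :: "'a set \<Rightarrow> ('a \<times> 'a) set \<Rightarrow> 'a set \<Rightarrow> 'a set \<Rightarrow> bool" where
  "dominating_join V E S D \<longleftrightarrow> simple_graph V E \<and> V = S \<union> D \<and> S \<inter> D = {}
    \<and> (\<forall>s\<in>S. \<forall>v\<in>V. v \<noteq> s \<longrightarrow> (s, v) \<in> E)"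

lemma dominating_joinD:
  assumes "dominating_join V E S D"
  shows "simple_graph V E" and "V = S \<union> D" and "S \<inter> D = {}"
    and "s \<in> S \<Longrightarrow> v \<in> V \<Longrightarrow> v \<noteq> s \<Longrightarrow> (s, v) \<in> E"
  using assms by (auto simp: dominating_join_def)

text \<open>
  On the complement the eigenvalue \<open>w\<close> becomes \<open>p\<close>, so one component
  \<open>D\<close> of the complement has at least \<open>p\<close> vertices. At most
  \<open>w\<close> vertices remain for at least \<open>w\<close> further components, so these are
  single vertices, and a vertex that is isolated in the complement is adjacent to all others.
\<close>

lemma dominating_vertices:
  fixes w p :: nat
  assumes G: "simple_graph V E" and card: "card V = w + p" and p: "p > 0" and w: "w > 0"
    and comps: "w < card (components V (complement_edges V E))"
    and ev: "eigenfunction V E (of_nat w) x" and v0: "v0 \<in> V" "x v0 \<noteq> 0"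
  shows "\<exists>S D. dominating_join V E S D \<and> card S = w \<and> card D = p"
proof -
  let ?F = "complement_edges V E"
  note F = simple_graph_complement[OF G]
  have "(\<Sum>v\<in>V. x v) = 0" using sum_eigenfunction_eq_0[OF G ev] w by simp
  then have evF: "eigenfunction V ?F (of_nat p) x"
    using ev by (simp add: eigenfunction_def lap_complement[OF G] card algebra_simps)
  then obtain D where D: "D \<in> components V ?F" "p \<le> card D"
    using eigenvalue_le_card_component[where x = x, OF F p evF v0] by blast
  let ?Q = "components V ?F - {D}"
  have fin: "finite (components V ?F)" by (rule componentsD(1)[OF F])
  have DV: "D \<subseteq> V" by (rule componentsD(4)[OF F D(1)])
  have pos: "1 \<le> card C" if "C \<in> ?Q" for C
    using that componentsD(3,4)[OF F, of C] simple_graphD(1)[OF G] finite_subset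
    by (metis DiffE One_nat_def Suc_leI card_gt_0_iff)
  have "card V = card D + (\<Sum>C\<in>?Q. card C)"
    using card_components_sum[OF F] sum.remove[OF fin D(1), of card] by simp
  then have le: "(\<Sum>C\<in>?Q. card C) + card D = w + p" using card by simp
  have "card ?Q \<le> (\<Sum>C\<in>?Q. card C)"
    using sum_mono[of ?Q "\<lambda>_. 1" card] pos by simp
  moreover have "w \<le> card ?Q" using comps fin D(1) by simp
  ultimately have sumQ: "(\<Sum>C\<in>?Q. card C) = card ?Q" and cD: "card D = p" and cQ: "card ?Q = w"
    using le D(2) by linarith+
  have single: "card C = 1" if "C \<in> ?Q" for C
  proof (rule ccontr)
    assume "card C \<noteq> 1"
    then have "1 < card C" using pos[OF that] by simp
    then have "(\<Sum>C\<in>?Q. 1) < (\<Sum>C\<in>?Q. card C)"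
      using fin pos that by (intro sum_strict_mono_ex1) auto
    then show False using sumQ by simp
  qed
  have "(s, v) \<in> E" if s: "s \<in> V - D" and v: "v \<in> V" "v \<noteq> s" for s v
  proof (rule ccontr)
    assume "(s, v) \<notin> E"
    then have sv: "(s, v) \<in> ?F" using s v by (auto simp: complement_edges_def)
    obtain C where C: "C \<in> components V ?F" "s \<in> C" using componentsD(2)[OF F] s by blast
    then have "C \<in> ?Q" using s by auto
    then obtain a where "C = {a}" using single by (auto simp: card_1_singleton_iff)
    moreover have "v \<in> C" using componentsD(7)[OF F C(1)] sv C(2) by auto
    ultimately show False using C(2) v by auto
  qed
  moreover have "card (V - D) = w"
    using card cD DV simple_graphD(1)[OF G] by (simp add: card_Diff_subset finite_subset)
  ultimately show ?thesis using cD DV G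
    by (intro exI[of _ "V - D"] exI[of _ D]) (auto simp: dominating_join_def)
qed

lemma lap_join:
  assumes join: "dominating_join V E S D"
  defines "H \<equiv> E \<inter> D \<times> D"
  shows "simple_graph D H"
    and "s \<in> S \<Longrightarrow> E `` {s} = V - {s}"
    and "v \<in> D \<Longrightarrow> E `` {v} = S \<union> H `` {v}"
    and "s \<in> S \<Longrightarrow> lap E x s = of_nat (card V) * x s - (\<Sum>u\<in>V. x u)"
    and "v \<in> D \<Longrightarrow> lap E x v = of_nat (card S) * x v - (\<Sum>u\<in>S. x u) + lap H x v"
proof -
  note G = dominating_joinD(1)[OF join] and V = dominating_joinD(2,3)[OF join]
  have fin: "finite S" "finite D" using simple_graphD(1)[OF G] V by auto
  show H: "simple_graph D H"
    using G fin by (auto simp: simple_graph_def H_def sym_def irrefl_def)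
  show S: "E `` {s} = V - {s}" if "s \<in> S" for s
    using dominating_joinD(4)[OF join that] simple_graphD(5,7)[OF G] by auto
  show D: "E `` {v} = S \<union> H `` {v}" if "v \<in> D" for v
    using dominating_joinD(4)[OF join, of _ v] that simple_graphD(4,7)[OF G, of v] V by (auto simp: H_def)
  show "lap E x s = of_nat (card V) * x s - (\<Sum>u\<in>V. x u)" if "s \<in> S" for s
  proof -
    have "lap E x s = (\<Sum>u\<in>V. x s - x u)"
      unfolding lap_def S[OF that] using simple_graphD(1)[OF G] by (intro sum.mono_neutral_left) auto
    then show ?thesis by (simp add: sum_subtractf)
  qed
  show "lap E x v = of_nat (card S) * x v - (\<Sum>u\<in>S. x u) + lap H x v" if "v \<in> D" for v
  proof -
    have "S \<inter> H `` {v} = {}" using V(2) by (auto simp: H_def)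
    then show ?thesis
      unfolding lap_def D[OF that] using fin simple_graphD(2)[OF H]
      by (simp add: sum.union_disjoint sum_subtractf card_Un_disjoint algebra_simps)
  qed
qed

text \<open>
  For \<open>s \<in> S\<close> the operator acts as \<open>card V * x s\<close> minus the total
  sum, which is zero for an eigenvalue other than zero. So \<open>x\<close> vanishes on
  \<open>S\<close>, and on \<open>D\<close> the vertices of \<open>S\<close> contribute only the
  shift by \<open>card S\<close>.
\<close>

lemma eigenfunction_join_iff:
  assumes join: "dominating_join V E S D"
    and \<mu>: "\<mu> \<noteq> 0" "\<mu> \<noteq> of_nat (card V)"
  shows "eigenfunction V E \<mu> x \<longleftrightarrow>
    (\<forall>s\<in>S. x s = 0) \<and> (\<Sum>v\<in>D. x v) = 0 \<and> eigenfunction D (E \<inter> D \<times> D) (\<mu> - of_nat (card S)) x"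
    (is "?l \<longleftrightarrow> ?r")
proof -
  note G = dominating_joinD(1)[OF join] and V = dominating_joinD(2,3)[OF join]
  note lj = lap_join[OF join]
  have "(\<Sum>u\<in>V. x u) = (\<Sum>u\<in>S. x u) + (\<Sum>u\<in>D. x u)"
    using simple_graphD(1)[OF G] V by (simp add: sum.union_disjoint)
  moreover have "lap E x s = of_nat (card V) * x s - (\<Sum>u\<in>V. x u)" if "s \<in> S" for s
    using lj(4) that by blast
  moreover have "lap E x v = of_nat (card S) * x v - (\<Sum>u\<in>S. x u) + lap (E \<inter> D \<times> D) x v" if "v \<in> D" for v
    using lj(5) that by blast
  note lap = calculation this
  show ?thesis
  proof
    assume l: ?l
    have sum0: "(\<Sum>u\<in>V. x u) = 0" by (rule sum_eigenfunction_eq_0[OF G l \<mu>(1)])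
    have S0: "x s = 0" if "s \<in> S" for s
    proof -
      have "of_nat (card V) * x s = \<mu> * x s"
        using l lap(2)[OF that] sum0 that V by (auto simp: eigenfunction_def)
      then show ?thesis using \<mu>(2) by simp
    qed
    then have "eigenfunction D (E \<inter> D \<times> D) (\<mu> - of_nat (card S)) x"
      using l lap(3) V by (auto simp: eigenfunction_def algebra_simps)
    then show ?r using S0 sum0 lap(1) by simp
  next
    assume ?r
    then show ?l using lap V by (auto simp: eigenfunction_def algebra_simps)
  qed
qed

lemma eigenfunction_join_card:
  assumes join: "dominating_join V E S D"
    and sum0: "(\<Sum>v\<in>V. x v) = 0" and const: "\<And>v. v \<in> D \<Longrightarrow> x v = c"
  shows "eigenfunction V E (of_nat (card V)) x"
proof -
  note G = dominating_joinD(1)[OF join] and V = dominating_joinD(2,3)[OF join]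
  note lj = lap_join[OF join]
  have fin: "finite S" "finite D" using simple_graphD(1)[OF G] V by auto
  have "(\<Sum>u\<in>S. x u) + (\<Sum>u\<in>D. x u) = 0"
    using sum0 fin V by (simp add: sum.union_disjoint)
  then have S: "(\<Sum>u\<in>S. x u) = - (of_nat (card D) * c)"
    using const by (simp add: eq_neg_iff_add_eq_0)
  have H0: "lap (E \<inter> D \<times> D) x v = 0" if "v \<in> D" for v
    using const that by (auto simp: lap_def)
  have cV: "card V = card S + card D" using fin V by (simp add: card_Un_disjoint)
  have "lap E x s = of_nat (card V) * x s" if "s \<in> S" for s
    using lj(4)[of s x] that sum0 by auto
  moreover have "lap E x v = of_nat (card V) * x v" if "v \<in> D" for v
    using lj(5)[of v x] that S H0[OF that] const[OF that] by (auto simp: cV algebra_simps)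
  ultimately show ?thesis using V by (auto simp: eigenfunction_def)
qed

lemma sum_degrees_join:
  fixes g :: "nat \<Rightarrow> nat"
  assumes join: "dominating_join V E S D"
  shows "(\<Sum>v\<in>V. g (card (E `` {v})))
    = card S * g (card V - 1) + (\<Sum>v\<in>D. g (card S + card ((E \<inter> D \<times> D) `` {v})))"
proof -
  note G = dominating_joinD(1)[OF join] and V = dominating_joinD(2,3)[OF join]
  note lj = lap_join[OF join]
  have fin: "finite S" "finite D" using simple_graphD(1)[OF G] V by auto
  have "card (E `` {s}) = card V - 1" if "s \<in> S" for s
    using lj(2)[of s] that V simple_graphD(1)[OF G] by (auto simp: card_Diff_singleton)
  moreover have "card (E `` {v}) = card S + card ((E \<inter> D \<times> D) `` {v})" if "v \<in> D" for v
  proof -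
    have "S \<inter> (E \<inter> D \<times> D) `` {v} = {}" using V(2) by auto
    moreover have "finite ((E \<inter> D \<times> D) `` {v})" using fin by (auto intro: finite_subset[of _ D])
    ultimately show ?thesis using lj(3)[of v] that fin by (auto simp: card_Un_disjoint)
  qed
  ultimately show ?thesis using fin V by (simp add: sum.union_disjoint)
qed

text \<open>
  The sum of \<open>(a v - c)\<^sup>2\<close> vanishes.
\<close>

lemma constant_if_variance_zero:
  fixes a :: "'a \<Rightarrow> int" and c :: int
  assumes "finite D" "(\<Sum>v\<in>D. a v) = card D * c" "(\<Sum>v\<in>D. (a v)\<^sup>2) = card D * c\<^sup>2" "v \<in> D"
  shows "a v = c"
proof -
  have "(\<Sum>v\<in>D. (a v - c)\<^sup>2) = (\<Sum>v\<in>D. (a v)\<^sup>2) - 2 * c * (\<Sum>v\<in>D. a v) + card D * c\<^sup>2"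
    by (simp add: power2_diff sum.distrib sum_subtractf mult.assoc mult.left_commute mult.commute
        flip: sum_distrib_left sum_distrib_right)
  also have "\<dots> = 0" using assms by (simp add: power2_eq_square algebra_simps)
  finally have "\<forall>v\<in>D. (a v - c)\<^sup>2 = 0" using assms(1) by (subst (asm) sum_nonneg_eq_0_iff) auto
  then show ?thesis using assms(4) by simp
qed

section \<open>Structure of the join of a complete graph with equal cycles\<close>

lemma digraph_isoI:
  assumes G: "pair_graph G" and T: "pair_graph T" and g: "bij_betw g (pverts G) (pverts T)"
    and adj: "\<And>u v. u \<in> pverts G \<Longrightarrow> v \<in> pverts G \<Longrightarrow> (u, v) \<in> parcs G \<longleftrightarrow> (g u, g v) \<in> parcs T"
  shows "digraph_iso (with_proj G) (with_proj T)"
proof -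
  interpret G: pair_graph G by fact
  interpret T: pair_graph T by fact
  let ?f = "\<lparr>iso_verts = g, iso_arcs = map_prod g g, iso_head = snd, iso_tail = fst\<rparr>"
  have inj: "inj_on g (pverts G)" and im: "g ` pverts G = pverts T"
    using g by (auto simp: bij_betw_def)
  have "parcs G \<subseteq> pverts G \<times> pverts G" using G.in_arcsD1 G.in_arcsD2 by auto
  then have "inj_on (map_prod g g) (parcs G)"
    using inj_on_subset[OF map_prod_inj_on[OF inj inj]] by blast
  then have "pre_digraph.digraph_isomorphism (with_proj G) ?f"
    using inj G.wf_digraph_axioms by (simp add: pre_digraph.digraph_isomorphism_def)
  moreover have "map_prod g g ` parcs G = parcs T"
  proof
    show "map_prod g g ` parcs G \<subseteq> parcs T"
    proof
      fix p assume "p \<in> map_prod g g ` parcs G"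
      then obtain u v where uv: "(u, v) \<in> parcs G" "p = (g u, g v)" by auto
      then show "p \<in> parcs T"
        using adj[OF G.in_arcsD1[OF uv(1)] G.in_arcsD2[OF uv(1)]] by simp
    qed
    show "parcs T \<subseteq> map_prod g g ` parcs G"
    proof safe
      fix a b assume ab: "(a, b) \<in> parcs T"
      have "a \<in> g ` pverts G" "b \<in> g ` pverts G"
        unfolding im using T.in_arcsD1[OF ab] T.in_arcsD2[OF ab] .
      then obtain u v where uv: "u \<in> pverts G" "v \<in> pverts G" "a = g u" "b = g v" by blast
      then have "(u, v) \<in> parcs G" using adj[OF uv(1,2)] ab by simp
      then show "(a, b) \<in> map_prod g g ` parcs G" using uv(3,4) by (metis imageI map_prod_simp)
    qed
  qed
  then have "with_proj T = app_iso ?f (with_proj G)"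
    using im by (simp add: app_iso_def with_proj_def)
  ultimately show ?thesis unfolding digraph_iso_def by blast
qed

lemma pred_mod_eq_iff:
  assumes "j < n" "k < n"
  shows "j = Suc k mod n \<longleftrightarrow> k = (j + n - 1) mod n"
  using assms by (cases j; cases "Suc k = n") (auto simp: mod_if)

abbreviation complete_join_cycles :: "nat \<Rightarrow> nat \<Rightarrow> nat \<Rightarrow> (nat + nat \<times> nat) pair_pre_digraph" where
  "complete_join_cycles w m n \<equiv> complete_graph w \<bigtriangledown> copies m (cycle_graph n)"

lemma pair_graph_complete_join_cycles:
  assumes "n \<ge> 3"
  shows "pair_graph (complete_join_cycles w m n)"
  using assms
  by (intro pair_graph_join pair_graph_complete_graph pair_graph_copies pair_graph_cycle_graph) auto

lemma complete_join_cycles_decomposition: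
  fixes w m n :: nat
  assumes n: "n \<ge> 3"
  defines "V \<equiv> pverts (complete_join_cycles w m n)" and "E \<equiv> parcs (complete_join_cycles w m n)"
    and "S \<equiv> Inl ` {..<w}" and "D \<equiv> Inr ` ({..<m} \<times> {..<n})"
  shows "dominating_join V E S D" and "V = S \<union> D" and "card S = w" and "card D = m * n"
    and "\<And>i. i < m \<Longrightarrow> cycle_on (E \<inter> D \<times> D) (Inr ` ({i} \<times> {..<n})) (\<lambda>j. Inr (i, j)) n"
    and "((Inr (i, j), Inr (i', j')) \<in> E \<longleftrightarrow> i < m \<and> i' = i \<and> j < n \<and> j' < n
      \<and> (j' = Suc j mod n \<or> j' = (j + n - 1) mod n))"
proof -
  have "simple_graph V E"
    unfolding V_def E_def by (rule simple_graph_pair_graph[OF pair_graph_complete_join_cycles[OF n]])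
  moreover show VSD: "V = S \<union> D"
    by (auto simp: V_def S_def D_def graph_join_def complete_graph_def copies_def cycle_graph_def Plus_def)
  moreover have "S \<inter> D = {}" by (auto simp: S_def D_def)
  moreover have "(s, v) \<in> E" if "s \<in> S" "v \<in> V" "v \<noteq> s" for s v
    using that by (auto simp: V_def E_def S_def graph_join_def complete_graph_def copies_def cycle_graph_def)
  ultimately show "dominating_join V E S D" by (auto simp: dominating_join_def)
  show "card S = w" by (simp add: S_def card_image)
  show "card D = m * n" by (simp add: D_def card_image)
  have arcs: "(Inr (i, j), Inr (i', j')) \<in> E \<longleftrightarrow> i < m \<and> i' = i \<and> j < n \<and> j' < n
      \<and> (j' = Suc j mod n \<or> j' = (j + n - 1) mod n)" for i j i' j'
    using pred_mod_eq_iff[of j n j']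
    by (auto simp: E_def graph_join_def complete_graph_def copies_def cycle_graph_def)
  then show "(Inr (i, j), Inr (i', j')) \<in> E \<longleftrightarrow> i < m \<and> i' = i \<and> j < n \<and> j' < n
      \<and> (j' = Suc j mod n \<or> j' = (j + n - 1) mod n)" .
  show "cycle_on (E \<inter> D \<times> D) (Inr ` ({i} \<times> {..<n})) (\<lambda>j. Inr (i, j)) n" if i: "i < m" for i
    unfolding cycle_on_def
  proof (intro conjI allI impI)
    show "bij_betw (\<lambda>j. Inr (i, j)) {..<n} (Inr ` ({i} \<times> {..<n}))"
      by (auto simp: bij_betw_def inj_on_def)
    fix j assume "j < n"
    then show "(E \<inter> D \<times> D) `` {Inr (i, j)} = {Inr (i, Suc j mod n), Inr (i, (j + n - 1) mod n)}"
      using i n by (auto simp: arcs D_def)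
  qed (rule n)
qed

lemma bij_betw_components_blocks:
  assumes G: "simple_graph D H" and e: "bij_betw e {..<m} (components D H)"
    and s: "\<And>i. i < m \<Longrightarrow> bij_betw (s i) {..<n} (e i)"
  shows "bij_betw (\<lambda>(i, j). s i j) ({..<m} \<times> {..<n :: nat}) D"
  unfolding bij_betw_def
proof
  have eC: "e i \<in> components D H" if "i < m" for i using e that by (auto simp: bij_betw_def)
  have sE: "s i j \<in> e i" if "i < m" "j < n" for i j
    using s[OF that(1)] that(2) by (auto simp: bij_betw_def)
  show "inj_on (\<lambda>(i, j). s i j) ({..<m} \<times> {..<n})"
  proof (rule inj_onI, clarsimp)
    fix i j i' j' assume a: "i < m" "j < n" "i' < m" "j' < n" "s i j = s i' j'"
    then have "e i \<inter> e i' \<noteq> {}" using sE[of i j] sE[of i' j'] by auto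
    then have "e i = e i'" using componentsD(5)[OF G eC eC] a by blast
    then have "i = i'" using e a by (auto simp: bij_betw_def inj_on_def)
    then show "i = i' \<and> j = j'" using s[of i] a by (auto simp: bij_betw_def inj_on_def)
  qed
  have "(\<lambda>(i, j). s i j) ` ({..<m} \<times> {..<n}) = (\<Union>i<m. s i ` {..<n})" by auto
  also have "\<dots> = (\<Union>i<m. e i)" using s by (auto simp: bij_betw_def)
  also have "\<dots> = D" using e componentsD(2)[OF G] by (auto simp: bij_betw_def)
  finally show "(\<lambda>(i, j). s i j) ` ({..<m} \<times> {..<n}) = D" .
qed

text \<open>
  The vertices of the complete graph are mapped bijectively to \<open>S\<close>, and the cycles to
  the components of the graph on \<open>D\<close> along their cyclic enumerations. This map is
  then inverted.
\<close>

lemma isomorphic_complete_join_cycles: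
  assumes G: "pair_graph G" and n: "n \<ge> 3"
    and join: "dominating_join (pverts G) (parcs G) S D" and cS: "card S = w"
    and cC: "card (components D (parcs G \<inter> D \<times> D)) = m"
    and cyc: "\<And>C. C \<in> components D (parcs G \<inter> D \<times> D) \<Longrightarrow> \<exists>s. cycle_on (parcs G \<inter> D \<times> D) C s n"
  shows "digraph_iso (with_proj G) (with_proj (complete_join_cycles w m n))"
proof -
  let ?E = "parcs G" and ?H = "parcs G \<inter> D \<times> D" and ?T = "complete_join_cycles w m n"
  note Gs = dominating_joinD(1)[OF join] and V = dominating_joinD(2,3)[OF join]
    and dom = dominating_joinD(4)[OF join]
  note T = complete_join_cycles_decomposition[OF n]
  note Ts = dominating_joinD(1)[OF T(1)] and T_dom = dominating_joinD(4)[OF T(1)]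
  have H: "simple_graph D ?H" using lap_join(1)[OF join] .
  have finS: "finite S" using simple_graphD(1)[OF Gs] V by simp
  obtain \<sigma> where \<sigma>: "bij_betw \<sigma> {..<w} S"
    using ex_bij_betw_nat_finite[OF finS] cS by (auto simp: atLeast0LessThan)
  obtain e where e: "bij_betw e {..<m} (components D ?H)"
    using ex_bij_betw_nat_finite[OF componentsD(1)[OF H]] cC by (auto simp: atLeast0LessThan)
  have eC: "e i \<in> components D ?H" if "i < m" for i using e that by (auto simp: bij_betw_def)
  then have "\<forall>i<m. \<exists>s. cycle_on ?H (e i) s n" using cyc by simp
  then obtain s where s: "\<And>i. i < m \<Longrightarrow> cycle_on ?H (e i) (s i) n" by metis
  have bs: "bij_betw (\<lambda>(i, j). s i j) ({..<m} \<times> {..<n}) D"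
    using s by (intro bij_betw_components_blocks[OF H e]) (auto simp: cycle_on_def)
  have inD: "s i j \<in> D" if "i < m" "j < n" for i j using bs that by (auto simp: bij_betw_def)
  have s_eq: "s i j = s i' j' \<longleftrightarrow> i = i' \<and> j = j'" if "i < m" "j < n" "i' < m" "j' < n" for i j i' j'
    using bs that by (auto simp: bij_betw_def inj_on_def)
  have adjD: "(s i j, s i' j') \<in> ?E \<longleftrightarrow> (Inr (i, j), Inr (i', j')) \<in> parcs ?T"
    if ij: "i < m" "j < n" "i' < m" "j' < n" for i j i' j'
  proof -
    have "(s i j, s i' j') \<in> ?E \<longleftrightarrow> s i' j' \<in> ?H `` {s i j}" using inD ij by auto
    also have "?H `` {s i j} = {s i (Suc j mod n), s i ((j + n - 1) mod n)}"
      using s[OF ij(1)] ij(2) by (auto simp: cycle_on_def)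
    finally show ?thesis using ij n by (auto simp: T(6) s_eq)
  qed
  define \<phi> where "\<phi> v = (case v of Inl u \<Rightarrow> \<sigma> u | Inr (i, j) \<Rightarrow> s i j)" for v
  have \<phi>S: "\<phi> v \<in> S" if "v \<in> Inl ` {..<w}" for v
    using that \<sigma> by (auto simp: \<phi>_def bij_betw_def)
  have "bij_betw \<phi> (Inl ` {..<w} \<union> Inr ` ({..<m} \<times> {..<n})) (S \<union> D)"
  proof (rule bij_betw_combine)
    show "bij_betw \<phi> (Inl ` {..<w}) S"
      using \<sigma> by (auto simp: bij_betw_def inj_on_def \<phi>_def image_image)
    show "bij_betw \<phi> (Inr ` ({..<m} \<times> {..<n})) D"
      using bs by (auto simp: bij_betw_def inj_on_def \<phi>_def image_image case_prod_unfold)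
  qed (rule V(2))
  then have b\<phi>: "bij_betw \<phi> (pverts ?T) (pverts G)" using V(1) T(2) by simp
  have adj: "(\<phi> u, \<phi> v) \<in> ?E \<longleftrightarrow> (u, v) \<in> parcs ?T" if uv: "u \<in> pverts ?T" "v \<in> pverts ?T" for u v
  proof (cases "u = v")
    case True
    then show ?thesis using simple_graphD(5)[OF Gs] simple_graphD(5)[OF Ts] by simp
  next
    case neq: False
    then have \<phi>neq: "\<phi> u \<noteq> \<phi> v" using b\<phi> uv by (auto simp: bij_betw_def inj_on_def)
    have \<phi>V: "\<phi> u \<in> pverts G" "\<phi> v \<in> pverts G" using b\<phi> uv by (auto simp: bij_betw_def)
    show ?thesis
    proof (cases "u \<in> Inl ` {..<w} \<or> v \<in> Inl ` {..<w}")
      case True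
      then have "(u, v) \<in> parcs ?T"
        using T_dom[where s = u and v = v] T_dom[where s = v and v = u] uv neq simple_graphD(4)[OF Ts, of u v] by auto
      moreover have "(\<phi> u, \<phi> v) \<in> ?E"
        using True \<phi>S uv dom[of "\<phi> u" "\<phi> v"] dom[of "\<phi> v" "\<phi> u"] \<phi>V \<phi>neq
          simple_graphD(4)[OF Gs, of "\<phi> u" "\<phi> v"] by auto
      ultimately show ?thesis by simp
    next
      case False
      then obtain i j i' j' where "u = Inr (i, j)" "v = Inr (i', j')" "i < m" "j < n" "i' < m" "j' < n"
        using uv unfolding T(2) by auto
      then show ?thesis using adjD by (simp add: \<phi>_def)
    qed
  qed
  have Tp: "pair_graph ?T" by (rule pair_graph_complete_join_cycles[OF n])
  show ?thesis
  proof (rule digraph_isoI[OF G Tp bij_betw_the_inv_into[OF b\<phi>]])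
    fix u v assume "u \<in> pverts G" "v \<in> pverts G"
    then have "u \<in> \<phi> ` pverts ?T" "v \<in> \<phi> ` pverts ?T"
      using bij_betw_imp_surj_on[OF b\<phi>] by simp_all
    then obtain u' v' where "u' \<in> pverts ?T" "v' \<in> pverts ?T" "u = \<phi> u'" "v = \<phi> v'"
      by blast
    then show "(u, v) \<in> ?E \<longleftrightarrow> (the_inv_into (pverts ?T) \<phi> u, the_inv_into (pverts ?T) \<phi> v) \<in> parcs ?T"
      using adj b\<phi> by (simp add: bij_betw_def the_inv_into_f_f)
  qed
qed

section \<open>Graphs cospectral with the join\<close>

lemma card_verts_cospectral:
  assumes G: "simple_graph (pverts G) (parcs G)" and n: "n \<ge> 3"
    and cospectral: "laplacian_spectrum G = laplacian_spectrum (complete_join_cycles w m n)"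
  shows "card (pverts G) = w + m * n"
    and "card (pverts (complete_join_cycles w m n)) = w + m * n"
proof -
  let ?T = "complete_join_cycles w m n"
  note T = complete_join_cycles_decomposition[OF n]
  note Ts = dominating_joinD(1)[OF T(1)]
  show T_card: "card (pverts ?T) = w + m * n"
    using dominating_joinD(3)[OF T(1)[of w m]] unfolding T(2) by (simp add: card_Un_disjoint T(3,4))
  show "card (pverts G) = w + m * n"
    using card_verts_eq_size_spectrum[OF G] card_verts_eq_size_spectrum[OF Ts] cospectral T_card
    by simp
qed

text \<open>
  In the join the eigenvalue \<open>w + m * n\<close> has \<open>w\<close> independent
  eigenfunctions: one for each vertex of the complete graph, balanced by a constant on the cycles.
  In \<open>G\<close>, eigenfunctions for the number of vertices are harmonic on the complement
  and have sum zero, so they are determined by one vertex from each component of the complement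
  except one.
\<close>

lemma complement_components_cospectral:
  assumes G: "simple_graph (pverts G) (parcs G)" and n: "n \<ge> 3" and m: "m > 0"
    and cospectral: "laplacian_spectrum G = laplacian_spectrum (complete_join_cycles w m n)"
  shows "w < card (components (pverts G) (complement_edges (pverts G) (parcs G)))"
proof -
  let ?T = "complete_join_cycles w m n" and ?V = "pverts G"
  let ?F = "complement_edges (pverts G) (parcs G)" and ?D = "Inr ` ({..<m} \<times> {..<n}) :: (nat + nat \<times> nat) set"
  note T = complete_join_cycles_decomposition[OF n]
  note Ts = dominating_joinD(1)[OF T(1)]
  note F = simple_graph_complement[OF G]
  note cV = card_verts_cospectral[OF G n cospectral]
  have mn: "m * n > 0" using m n by simp
  then have "?V \<noteq> {}" using cV(1) by auto
  then obtain C0 where C0: "C0 \<in> components ?V ?F" using componentsD(2)[OF F] by auto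
  obtain J where J: "J \<subseteq> ?V" "card J \<le> card (components ?V ?F) - 1"
    "\<And>x v. eigenfunction ?V ?F 0 x \<Longrightarrow> (\<Sum>v\<in>?V. x v) = 0 \<Longrightarrow> \<forall>j\<in>J. x j = 0 \<Longrightarrow> v \<in> ?V \<Longrightarrow> x v = 0"
    using components_determining_set[OF F C0] by blast
  define f :: "nat \<Rightarrow> nat + nat \<times> nat \<Rightarrow> complex"
    where "f u v = (if v = Inl u then of_nat (m * n) else if v \<in> ?D then - 1 else 0)" for u v
  have "card {..<w} \<le> card J"
  proof (rule card_independent_eigenfunctions_le[OF Ts G cospectral[symmetric],
        of "of_nat (w + m * n)" "{..<w}" f])
    show "eigenfunction (pverts ?T) (parcs ?T) (of_nat (w + m * n)) (f u)" if u: "u \<in> {..<w}" for u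
      unfolding cV(2)[symmetric]
    proof (rule eigenfunction_join_card[OF T(1)])
      have "(\<Sum>v\<in>pverts ?T. f u v) = (\<Sum>v\<in>Inl ` {..<w}. f u v) + (\<Sum>v\<in>?D. f u v)"
        unfolding T(2) by (rule sum.union_disjoint) auto
      also have "(\<Sum>v\<in>?D. f u v) = (\<Sum>v\<in>?D. - 1)" by (rule sum.cong) (auto simp: f_def)
      also have "\<dots> = - of_nat (m * n)" using T(4)[of m] by simp
      also have "(\<Sum>v\<in>Inl ` {..<w}. f u v) = (\<Sum>i<w. f u (Inl i))"
        by (simp add: sum.reindex)
      also have "\<dots> = (\<Sum>i<w. if i = u then of_nat (m * n) else 0)"
        by (rule sum.cong) (auto simp: f_def)
      also have "\<dots> = of_nat (m * n)" using u by simp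
      finally show "(\<Sum>v\<in>pverts ?T. f u v) = 0" by simp
      show "f u v = - 1" if "v \<in> ?D" for v using that by (auto simp: f_def)
    qed
    show "\<forall>u\<in>{..<w}. c u = 0"
      if c: "\<And>v. v \<in> pverts ?T \<Longrightarrow> (\<Sum>u<w. c u * f u v) = 0" for c :: "nat \<Rightarrow> complex"
    proof
      fix i assume i: "i \<in> {..<w}"
      have "(\<Sum>u<w. c u * f u (Inl i)) = (\<Sum>u<w. if u = i then c i * of_nat (m * n) else 0)"
        by (rule sum.cong) (auto simp: f_def)
      then show "c i = 0" using c[of "Inl i"] i mn unfolding T(2) by simp
    qed
    show "x v = 0" if x: "eigenfunction ?V (parcs G) (of_nat (w + m * n)) x" "\<forall>j\<in>J. x j = 0"
      and v: "v \<in> ?V" for x v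
    proof -
      have ne: "of_nat (w + m * n) \<noteq> (0 :: complex)" using mn by (simp only: of_nat_eq_0_iff)
      have sum0: "(\<Sum>v\<in>?V. x v) = 0" by (rule sum_eigenfunction_eq_0[OF G x(1) ne])
      then have "eigenfunction ?V ?F 0 x"
        using x(1) by (simp add: eigenfunction_def lap_complement[OF G] cV(1))
      then show ?thesis using J(3) sum0 x(2) v by blast
    qed
  qed (use J(1) in auto)
  moreover have "card (components ?V ?F) > 0"
    using C0 componentsD(1)[OF F] by (auto simp: card_gt_0_iff)
  ultimately show ?thesis using J(2) by simp
qed

text \<open>
  In the join, the function that is \<open>1\<close> on the first cycle, \<open>-1\<close> on the
  second and \<open>0\<close> elsewhere has the eigenvalue \<open>w\<close>. This is where two
  copies of the cycle are needed.
\<close>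

lemma eigenfunction_cospectral_copies:
  assumes G: "simple_graph (pverts G) (parcs G)" and n: "n \<ge> 3" and m: "m \<ge> 2" and w: "w > 0"
    and cospectral: "laplacian_spectrum G = laplacian_spectrum (complete_join_cycles w m n)"
  shows "\<exists>x v. eigenfunction (pverts G) (parcs G) (of_nat w) x \<and> v \<in> pverts G \<and> x v \<noteq> 0"
proof -
  let ?T = "complete_join_cycles w m n" and ?D = "Inr ` ({..<m} \<times> {..<n}) :: (nat + nat \<times> nat) set"
  let ?H = "parcs ?T \<inter> ?D \<times> ?D"
  note T = complete_join_cycles_decomposition[OF n]
  note Ts = dominating_joinD(1)[OF T(1)]
  note cV = card_verts_cospectral[OF G n cospectral]
  define x :: "nat + nat \<times> nat \<Rightarrow> complex" where
    "x v = (case v of Inl u \<Rightarrow> 0 | Inr (i, j) \<Rightarrow> if i = 0 then 1 else if i = 1 then - 1 else 0)" for v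
  have "(\<Sum>v\<in>?D. x v) = (\<Sum>(i, j)\<in>{..<m} \<times> {..<n}. x (Inr (i, j)))"
    by (subst sum.reindex) (auto simp: case_prod_unfold)
  also have "\<dots> = (\<Sum>i<m. \<Sum>j<n. x (Inr (i, j)))" by (simp add: sum.cartesian_product)
  also have "\<dots> = (\<Sum>i<m. (if i = 0 then of_nat n else 0) - (if i = 1 then of_nat n else 0))"
    by (rule sum.cong) (auto simp: x_def)
  also have "\<dots> = 0" using m by (simp add: sum_subtractf)
  finally have sum0: "(\<Sum>v\<in>?D. x v) = 0" .
  have "lap ?H x v = 0" if "v \<in> ?D" for v
    unfolding lap_def by (rule sum.neutral) (auto simp: x_def T(6))
  then have "eigenfunction ?D ?H 0 x" by (simp add: eigenfunction_def)
  moreover have "of_nat w \<noteq> (of_nat (card (pverts ?T)) :: complex)"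
    unfolding cV(2) of_nat_eq_iff using m n by simp
  ultimately have ev: "eigenfunction (pverts ?T) (parcs ?T) (of_nat w) x"
    using sum0 w by (subst eigenfunction_join_iff[OF T(1)])
      (auto simp: T(3) x_def)
  have "Inr (0, 0) \<in> pverts ?T" using m n unfolding T(2) by auto
  moreover have "x (Inr (0, 0)) \<noteq> 0" by (simp add: x_def)
  ultimately show ?thesis using cospectral_eigenfunction[OF G Ts cospectral _ ev] by simp
qed

text \<open>
  The vertices of \<open>S\<close> have the same degree as those of the complete graph in the
  join. So the traces of \<open>L\<close> and \<open>L\<^sup>2\<close> say that the degrees on
  \<open>D\<close> have the same sum and the same sum of squares as in a graph that is regular on
  \<open>D\<close> of degree \<open>w + 2\<close>.
\<close>

lemma two_regular_cospectral:
  assumes G: "simple_graph (pverts G) (parcs G)" and n: "n \<ge> 3"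
    and cospectral: "laplacian_spectrum G = laplacian_spectrum (complete_join_cycles w m n)"
    and join: "dominating_join (pverts G) (parcs G) S D" and cS: "card S = w" and cD: "card D = m * n"
    and v: "v \<in> D"
  shows "card ((parcs G \<inter> D \<times> D) `` {v}) = 2"
proof -
  note V = dominating_joinD(2,3)[OF join]
  let ?T = "complete_join_cycles w m n" and ?D = "Inr ` ({..<m} \<times> {..<n}) :: (nat + nat \<times> nat) set"
  let ?H = "parcs G \<inter> D \<times> D" and ?K = "parcs ?T \<inter> ?D \<times> ?D"
  note T = complete_join_cycles_decomposition[OF n]
  note Ts = dominating_joinD(1)[OF T(1)]
  note cV = card_verts_cospectral[OF G n cospectral]
  have finD: "finite D" using simple_graphD(1)[OF G] V by simp
  have K2: "card (?K `` {v}) = 2" if v: "v \<in> ?D" for v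
  proof -
    obtain i j where ij: "i < m" "j < n" "v = Inr (i, j)" using v by auto
    have "?K `` {v} = {Inr (i, Suc j mod n), Inr (i, (j + n - 1) mod n)}"
      using T(5)[OF ij(1)] ij by (simp add: cycle_on_def)
    moreover have "Suc j mod n \<noteq> (j + n - 1) mod n"
      using ij(2) n by (cases j; cases "Suc j = n") (auto simp: mod_if)
    ultimately show ?thesis by simp
  qed
  have *: "(\<Sum>v\<in>D. g (w + card (?H `` {v}))) = m * n * g (w + 2)"
    if eq: "(\<Sum>v\<in>pverts G. g (card (parcs G `` {v}))) = (\<Sum>v\<in>pverts ?T. g (card (parcs ?T `` {v})))"
    for g :: "nat \<Rightarrow> nat"
  proof -
    have "w * g (w + m * n - 1) + (\<Sum>v\<in>D. g (w + card (?H `` {v})))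
        = (\<Sum>v\<in>pverts G. g (card (parcs G `` {v})))"
      using sum_degrees_join[OF join, of g] by (simp add: cS cV)
    also have "\<dots> = w * g (w + m * n - 1) + (\<Sum>v\<in>?D. g (w + card (?K `` {v})))"
      using sum_degrees_join[OF T(1)[of w m], of g] eq by (simp add: T(3) cV)
    also have "(\<Sum>v\<in>?D. g (w + card (?K `` {v}))) = (\<Sum>v\<in>?D. g (w + 2))"
      using K2 by (intro sum.cong) auto
    also have "\<dots> = m * n * g (w + 2)" using T(4)[of m] by simp
    finally show ?thesis by simp
  qed
  have "complex_of_nat (\<Sum>v\<in>pverts G. card (parcs G `` {v}))
      = of_nat (\<Sum>v\<in>pverts ?T. card (parcs ?T `` {v}))"
    using sum_degrees_eq_spectral(1)[OF G] sum_degrees_eq_spectral(1)[OF Ts] cospectral by simp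
  from *[of "\<lambda>d. d", OF this[unfolded of_nat_eq_iff]]
  have s1: "(\<Sum>v\<in>D. w + card (?H `` {v})) = m * n * (w + 2)" .
  have "complex_of_nat (\<Sum>v\<in>pverts G. (card (parcs G `` {v}))\<^sup>2 + card (parcs G `` {v}))
      = of_nat (\<Sum>v\<in>pverts ?T. (card (parcs ?T `` {v}))\<^sup>2 + card (parcs ?T `` {v}))"
    using sum_degrees_eq_spectral(2)[OF G] sum_degrees_eq_spectral(2)[OF Ts] cospectral by simp
  from *[of "\<lambda>d. d\<^sup>2 + d", OF this[unfolded of_nat_eq_iff]]
  have s2: "(\<Sum>v\<in>D. (w + card (?H `` {v}))\<^sup>2 + (w + card (?H `` {v}))) = m * n * ((w + 2)\<^sup>2 + (w + 2))" .
  have s2': "(\<Sum>v\<in>D. (w + card (?H `` {v}))\<^sup>2) = m * n * (w + 2)\<^sup>2"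
    using s2 s1 by (simp only: sum.distrib distrib_left add_right_cancel)
  have "int (w + card (?H `` {v})) = int (w + 2)"
  proof (rule constant_if_variance_zero[OF finD _ _ v])
    show "(\<Sum>v\<in>D. int (w + card (?H `` {v}))) = int (card D) * int (w + 2)"
      using arg_cong[OF s1, of int] unfolding of_nat_sum of_nat_mult cD .
    show "(\<Sum>v\<in>D. (int (w + card (?H `` {v})))\<^sup>2) = int (card D) * (int (w + 2))\<^sup>2"
      using arg_cong[OF s2', of int] unfolding of_nat_sum of_nat_mult of_nat_power cD .
  qed
  then show ?thesis by simp
qed

text \<open>
  Eigenfunctions for \<open>w\<close> live on \<open>D\<close>, are harmonic there and have sum
  zero. In \<open>G\<close> the normalised indicators of the components, relative to a fixed
  component \<open>C0\<close>, are independent eigenfunctions of this kind. In the join such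
  functions are determined by one vertex from each cycle except the last.
\<close>

lemma card_components_cospectral:
  assumes G: "simple_graph (pverts G) (parcs G)" and n: "n \<ge> 3" and m: "m > 0" and w: "w > 0"
    and cospectral: "laplacian_spectrum G = laplacian_spectrum (complete_join_cycles w m n)"
    and join: "dominating_join (pverts G) (parcs G) S D" and cS: "card S = w" and cD: "card D = m * n"
  shows "card (components D (parcs G \<inter> D \<times> D)) \<le> m"
proof -
  note V = dominating_joinD(2,3)[OF join]
  let ?T = "complete_join_cycles w m n" and ?H = "parcs G \<inter> D \<times> D"
  let ?DT = "Inr ` ({..<m} \<times> {..<n}) :: (nat + nat \<times> nat) set"
  let ?K = "parcs ?T \<inter> ?DT \<times> ?DT"
  note T = complete_join_cycles_decomposition[OF n]
  note Ts = dominating_joinD(1)[OF T(1)]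
  note cV = card_verts_cospectral[OF G n cospectral]
  have H: "simple_graph D ?H" and K: "simple_graph ?DT ?K"
    using lap_join(1)[OF join] lap_join(1)[OF T(1)] .
  have ne: "of_nat w \<noteq> (0 :: complex)" "of_nat w \<noteq> complex_of_nat (card (pverts G))"
    "of_nat w \<noteq> complex_of_nat (card (pverts ?T))"
    unfolding cV of_nat_eq_iff using w m n by auto
  have finD: "finite D" by (rule simple_graphD(1)[OF H])
  have "D \<noteq> {}" using cD m n by auto
  then obtain C0 where C0: "C0 \<in> components D ?H" using componentsD(2)[OF H] by auto
  let ?I = "components D ?H - {C0}"
  note fin = componentsD(1)[OF H]
  have finC: "finite C" "card C \<noteq> 0" if "C \<in> components D ?H" for C
    using that componentsD(3,4)[OF H that] finite_subset[OF _ finD] by auto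
  define ind :: "'a set \<Rightarrow> 'a \<Rightarrow> complex" where "ind C v = (if v \<in> C then 1 / of_nat (card C) else 0)" for C v
  define f where "f C v = ind C v - ind C0 v" for C v
  define J :: "(nat + nat \<times> nat) set" where "J = (\<lambda>i. Inr (i, 0)) ` {..<m - 1}"
  have "card ?I \<le> card J"
  proof (rule card_independent_eigenfunctions_le[OF G Ts cospectral, of "of_nat w" ?I f])
    show "eigenfunction (pverts G) (parcs G) (of_nat w) (f C)" if C: "C \<in> ?I" for C
    proof -
      have "ind C s = 0" if "s \<in> S" "C \<in> components D ?H" for s C
        using componentsD(4)[OF H that(2)] that(1) V(2) by (auto simp: ind_def)
      then have "\<forall>s\<in>S. f C s = 0" using C C0 by (simp add: f_def)
      moreover have "(\<Sum>v\<in>D. ind C v) = 1" if C: "C \<in> components D ?H" for C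
      proof -
        have "(\<Sum>v\<in>D. ind C v) = (\<Sum>v\<in>C. 1 / of_nat (card C))"
          using componentsD(4)[OF H C] finD by (intro sum.mono_neutral_cong_right) (auto simp: ind_def)
        then show ?thesis using finC[OF C] by simp
      qed
      then have "(\<Sum>v\<in>D. f C v) = 0" using C C0 by (simp add: f_def sum_subtractf)
      moreover have "eigenfunction D ?H 0 (f C)"
      proof -
        have "ind C u = ind C v" if "(v, u) \<in> ?H" "C \<in> components D ?H" for u v C
          using componentsD(7)[OF H that(2)] that(1) simple_graphD(4)[OF H, of u v] by (auto simp: ind_def)
        then have "lap ?H (f C) v = 0" for v
          using C C0 unfolding lap_def f_def by (intro sum.neutral) auto
        then show ?thesis by (simp add: eigenfunction_def)
      qed
      ultimately show ?thesis
        using ne by (subst eigenfunction_join_iff[OF join]) (auto simp: cS)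
    qed
    show "\<forall>C\<in>?I. c C = 0"
      if c: "\<And>v. v \<in> pverts G \<Longrightarrow> (\<Sum>C\<in>?I. c C * f C v) = 0" for c :: "'a set \<Rightarrow> complex"
    proof
      fix C assume C: "C \<in> ?I"
      then obtain v where v: "v \<in> C" using componentsD(3)[OF H] by blast
      have vD: "v \<in> D" using componentsD(4)[OF H] C v by blast
      have "f C' v = (if C' = C then 1 / of_nat (card C) else 0)" if "C' \<in> ?I" for C'
        using componentsD(5)[OF H, of C' C] componentsD(5)[OF H, of C0 C] that C C0 v
        by (auto simp: f_def ind_def)
      then have "(\<Sum>C'\<in>?I. c C' * f C' v) = (\<Sum>C'\<in>?I. if C' = C then c C / of_nat (card C) else 0)"
        by (intro sum.cong) auto
      also have "\<dots> = c C / of_nat (card C)" using fin C by simp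
      finally show "c C = 0" using c[of v] vD V(1) finC C by auto
    qed
    show "J \<subseteq> pverts ?T" using n unfolding J_def T(2) by auto
    show "y v = 0" if y: "eigenfunction (pverts ?T) (parcs ?T) (of_nat w) y" "\<forall>j\<in>J. y j = 0"
      and v: "v \<in> pverts ?T" for y v
    proof -
      have y0: "\<forall>s\<in>Inl ` {..<w}. y s = 0" and ysum: "(\<Sum>v\<in>?DT. y v) = 0"
        and yH: "eigenfunction ?DT ?K 0 y"
        using y(1) eigenfunction_join_iff[OF T(1)[of w m] ne(1,3), of y] by (simp_all add: T(3))
      have const: "y (Inr (i, j)) = y (Inr (i, 0))" if "i < m" "j < n" for i j
        using that(2)
      proof (induction j)
        case (Suc j)
        then have "(Inr (i, j), Inr (i, Suc j)) \<in> ?K" using that(1) by (auto simp: T(6))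
        from harmonic_adjacent_eq[OF K yH this] show ?case using Suc by simp
      qed simp
      have zero: "y (Inr (i, 0)) = 0" if "i < m - 1" for i using y(2) that by (auto simp: J_def)
      have row: "(\<Sum>j<n. y (Inr (i, j))) = of_nat n * y (Inr (i, 0))" if "i < m" for i
      proof -
        have "(\<Sum>j<n. y (Inr (i, j))) = (\<Sum>j<n. y (Inr (i, 0)))"
          by (rule sum.cong[OF refl], rule const) (use that in auto)
        then show ?thesis by simp
      qed
      have "(\<Sum>v\<in>?DT. y v) = (\<Sum>(i, j)\<in>{..<m} \<times> {..<n}. y (Inr (i, j)))"
        by (subst sum.reindex) (auto simp: case_prod_unfold)
      also have "\<dots> = (\<Sum>i<m. \<Sum>j<n. y (Inr (i, j)))" by (simp add: sum.cartesian_product)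
      also have "\<dots> = (\<Sum>i<m. of_nat n * y (Inr (i, 0)))"
        by (rule sum.cong) (auto simp: row)
      also have "\<dots> = (\<Sum>i<m - 1. of_nat n * y (Inr (i, 0))) + of_nat n * y (Inr (m - 1, 0))"
        using m by (cases m) auto
      finally have "y (Inr (m - 1, 0)) = 0" using ysum zero n by simp
      then have zero': "y (Inr (i, 0)) = 0" if "i < m" for i
        using zero[of i] that by (cases "i = m - 1") auto
      have "y (Inr (i, j)) = 0" if "i < m" "j < n" for i j
        using const[OF that] zero'[OF that(1)] by simp
      then show "y v = 0" using y0 v unfolding T(2) by auto
    qed
  qed (use fin in auto)
  also have "card J = m - 1" unfolding J_def by (simp add: card_image inj_on_def)
  finally show ?thesis using fin C0 m by simp
qed

text \<open>
  With \<open>z = exp (2 \<pi> \<i> / l)\<close>, the cycle of length \<open>l\<close> contributes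
  the eigenvalue \<open>w + 2 - z - 1 / z\<close> to \<open>G\<close>. In the join this eigenvalue
  must come from one of the cycles of length \<open>n\<close>, whence \<open>z ^ n = 1\<close> and
  \<open>l\<close> divides \<open>n\<close>.
\<close>

lemma cycle_length_le_cospectral:
  assumes G: "simple_graph (pverts G) (parcs G)" and n: "n \<ge> 3" and m: "m \<ge> 2" and w: "w > 0"
    and cospectral: "laplacian_spectrum G = laplacian_spectrum (complete_join_cycles w m n)"
    and join: "dominating_join (pverts G) (parcs G) S D" and cS: "card S = w"
    and C: "C \<in> components D (parcs G \<inter> D \<times> D)" and c: "cycle_on (parcs G \<inter> D \<times> D) C s l"
  shows "l \<le> n"
proof -
  note V = dominating_joinD(2,3)[OF join]
  let ?T = "complete_join_cycles w m n" and ?H = "parcs G \<inter> D \<times> D"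
  let ?DT = "Inr ` ({..<m} \<times> {..<n}) :: (nat + nat \<times> nat) set"
  let ?K = "parcs ?T \<inter> ?DT \<times> ?DT"
  note T = complete_join_cycles_decomposition[OF n]
  note Ts = dominating_joinD(1)[OF T(1)]
  note cV = card_verts_cospectral[OF G n cospectral]
  have H: "simple_graph D ?H" using lap_join(1)[OF join] .
  have l: "3 \<le> l" and sC: "s 0 \<in> C" using c by (auto simp: cycle_on_def bij_betw_def)
  then have l0: "0 < l" by simp
  have sD: "s 0 \<in> D" using sC componentsD(4)[OF H C] by blast
  define z where "z = cis (2 * pi / l)"
  have zl: "z ^ l = 1" and dvd: "\<And>k. z ^ k = 1 \<Longrightarrow> l dvd k"
    using cis_root_of_unity[OF l0] by (simp_all add: z_def)
  have z0: "z \<noteq> 0" by (simp add: z_def)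
  have z1: "z \<noteq> 1" using dvd[of 1] l by auto
  define \<mu> where "\<mu> = real w + 2 - 2 * cos (2 * pi / l)"
  have "1 / z = cnj z" by (simp add: z_def cis_cnj divide_inverse)
  then have \<mu>: "complex_of_real \<mu> - of_nat w = 2 - z - 1 / z"
    by (simp add: \<mu>_def z_def complex_eq_iff)
  \<comment> \<open>\<open>\<mu>\<close> lies between \<open>w\<close> and \<open>w + 4\<close>, so it is neither \<open>0\<close> nor the number of vertices,
    and its eigenfunctions vanish on the dominating vertices.\<close>
  have "6 \<le> m * n" using mult_le_mono[OF m n] by simp
  then have "6 \<le> real (m * n)" by linarith
  then have "0 < \<mu>" "\<mu> < real (w + m * n)"
    using w cos_le_one[of "2 * pi / l"] cos_ge_minus_one[of "2 * pi / l"]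
    unfolding \<mu>_def of_nat_add by linarith+
  then have ne: "complex_of_real \<mu> \<noteq> 0" "complex_of_real \<mu> \<noteq> of_nat (w + m * n)"
    by (simp, metis less_irrefl of_real_eq_iff of_real_of_nat_eq)
  obtain x where x: "eigenfunction D ?H (2 - z - 1 / z) x" "x (s 0) = 1"
    using cycle_eigenfunction[OF H C c zl] by blast
  \<comment> \<open>The extension of \<open>x\<close> by zero needs sum zero on \<open>D\<close>.\<close>
  have "(z - 1)\<^sup>2 = - (2 - z - 1 / z) * z" using z0 by (simp add: field_simps power2_eq_square)
  then have "2 - z - 1 / z \<noteq> 0" using z1 by auto
  then have xsum: "(\<Sum>v\<in>D. x v) = 0" using sum_eigenfunction_eq_0[OF H x(1)] by blast
  define x' where "x' v = (if v \<in> D then x v else 0)" for v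
  have "lap ?H x' v = lap ?H x v" if "v \<in> D" for v
    using that by (auto simp: lap_def x'_def intro!: sum.cong)
  then have "eigenfunction D ?H (2 - z - 1 / z) x'" using x(1) by (simp add: eigenfunction_def x'_def)
  moreover have "(\<Sum>v\<in>D. x' v) = 0" using xsum by (simp add: x'_def)
  moreover have "\<forall>s\<in>S. x' s = 0" using V(2) by (auto simp: x'_def)
  ultimately have evG: "eigenfunction (pverts G) (parcs G) (of_real \<mu>) x'"
    using eigenfunction_join_iff[OF join, of "of_real \<mu>" x'] ne by (simp add: cV cS \<mu>)
  have "s 0 \<in> pverts G" "x' (s 0) \<noteq> 0" using sD x(2) V(1) by (auto simp: x'_def)
  then obtain y u where y: "eigenfunction (pverts ?T) (parcs ?T) (of_real \<mu>) y"
      and u: "u \<in> pverts ?T" "y u \<noteq> 0"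
    using cospectral_eigenfunction[OF Ts G cospectral[symmetric] complex_cnj_complex_of_real evG] by blast
  have y0: "\<forall>s\<in>Inl ` {..<w}. y s = 0" and yK: "eigenfunction ?DT ?K (2 - z - 1 / z) y"
    using y eigenfunction_join_iff[OF T(1)[of w m], of "of_real \<mu>" y] ne
    by (simp_all add: cV T(3) \<mu>)
  obtain i j where ij: "i < m" "j < n" "u = Inr (i, j)" using u y0 unfolding T(2) by auto
  have "z ^ n = 1"
  proof (rule cycle_eigenvalue_root_of_unity[OF T(5)[OF ij(1)] z0])
    show "lap ?K y v = (2 - z - 1 / z) * y v" if "v \<in> Inr ` ({i} \<times> {..<n})" for v
      using yK that ij(1) by (auto simp: eigenfunction_def)
    show "u \<in> Inr ` ({i} \<times> {..<n})" "y u \<noteq> 0" using ij u by auto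
  qed
  then show "l \<le> n" using dvd n by (auto intro: dvd_imp_le)
qed

text \<open>
  The sum is at most \<open>card Q * n\<close>, which is at most \<open>m * n\<close>, so both
  estimates are equalities.
\<close>

lemma tight_sum_of_bounded:
  fixes a :: "'a \<Rightarrow> nat"
  assumes "finite Q" "card Q \<le> m" "(\<Sum>C\<in>Q. a C) = m * n" "\<And>C. C \<in> Q \<Longrightarrow> a C \<le> n" "n > 0"
  shows "card Q = m" and "C \<in> Q \<Longrightarrow> a C = n"
proof -
  have le: "(\<Sum>C\<in>Q. a C) \<le> card Q * n" using sum_bounded_above[of Q a n] assms(4) by simp
  then show cQ: "card Q = m" using assms by auto
  show "a C = n" if C: "C \<in> Q"
  proof (rule ccontr)
    assume "a C \<noteq> n"
    then have "a C < n" using assms(4)[OF C] by simp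
    then have "(\<Sum>C\<in>Q. a C) < (\<Sum>C\<in>Q. n)"
      using assms(1,4) C by (intro sum_strict_mono_ex1) auto
    then show False using assms(3) cQ by simp
  qed
qed

theorem theorem6p1:
  fixes w m n :: nat and G :: "'a pair_pre_digraph"
  assumes "w \<ge> 1" and "m \<ge> 1" and "n \<ge> 3"
    and "w \<noteq> 1" and "m \<noteq> 1" and "n \<noteq> 6"
    and "pair_graph G" and "Digraph_Component.connected (with_proj G)"
    and "laplacian_spectrum G
      = laplacian_spectrum (complete_graph w \<bigtriangledown> copies m (cycle_graph n))"
  shows "digraph_iso (with_proj G)
    (with_proj (complete_graph w \<bigtriangledown> copies m (cycle_graph n)))"
proof -
  note n = \<open>n \<ge> 3\<close> and cospectral = assms(9)
  have w: "w > 0" and m: "m > 0" "m \<ge> 2" using assms by auto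
  note G = simple_graph_pair_graph[OF \<open>pair_graph G\<close>]
  obtain x v where x: "eigenfunction (pverts G) (parcs G) (of_nat w) x" "v \<in> pverts G" "x v \<noteq> 0"
    using eigenfunction_cospectral_copies[OF G n m(2) w cospectral] by blast
  have mn: "m * n > 0" using m n by simp
  obtain S D where join: "dominating_join (pverts G) (parcs G) S D"
    and cS: "card S = w" and cD: "card D = m * n"
    using dominating_vertices[OF G card_verts_cospectral(1)[OF G n cospectral] mn w
        complement_components_cospectral[OF G n m(1) cospectral] x] by blast
  let ?H = "parcs G \<inter> D \<times> D"
  have H: "simple_graph D ?H" using lap_join(1)[OF join] .
  have cycle: "\<exists>s. cycle_on ?H C s (card C) \<and> card C \<le> n" if C: "C \<in> components D ?H" for C
  proof -
    obtain s l where c: "cycle_on ?H C s l"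
      using two_regular_component_cycle[OF H two_regular_cospectral[OF G n cospectral join cS cD] C]
      by blast
    then have "card C = l" using bij_betw_same_card[of s "{..<l}" C] by (simp add: cycle_on_def)
    then show ?thesis
      using c cycle_length_le_cospectral[OF G n m(2) w cospectral join cS C c] by blast
  qed
  have "card (components D ?H) \<le> m"
    by (rule card_components_cospectral[OF G n m(1) w cospectral join cS cD])
  note all = tight_sum_of_bounded[OF componentsD(1)[OF H] this, of card n]
  have sum: "(\<Sum>C\<in>components D ?H. card C) = m * n" using card_components_sum[OF H] cD by simp
  have "card (components D ?H) = m" using all(1) sum cycle n by auto
  moreover have "\<exists>s. cycle_on ?H C s n" if C: "C \<in> components D ?H" for C
  proof -
    have "card C = n" using all(2)[OF sum _ _ C] cycle n by auto
    then show ?thesis using cycle[OF C] by auto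
  qed
  ultimately show ?thesis
    by (rule isomorphic_complete_join_cycles[OF \<open>pair_graph G\<close> n join cS])
qed

end
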